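(* Let $G$ be a finite group, $K\leq G$ a subgroup and $(\theta,V)$ a $K$-representation. For $F\in\widetilde{\mathcal H}(G,K,\theta)$, $f\in \mathrm{Ind}_K^GV$ and $g\in G$ put $$[\xi(F)f](g)=\sum_{h\in G}F(h^{-1}g)f(h).$$ Then $\xi(F)\in\mathrm{End}_G(\mathrm{Ind}_K^GV)$ for all $F\in\widetilde{\mathcal H}(G,K,\theta)$, and $\xi$ is a $*$-isomorphism of $*$-algebras from $\widetilde{\mathcal H}(G,K,\theta)$ onto $\mathrm{End}_G(\mathrm{Ind}_K^GV)$. Moreover $$\langle \xi(F_1),\xi(F_2)\rangle_{\mathrm{End}_G(\mathrm{Ind}_K^GV)}=|K|\,\langle F_1,F_2\rangle_{\widetilde{\mathcal H}(G,K,\theta)}$$ for all $F_1,F_2\in\widetilde{\mathcal H}(G,K,\theta)$; that is, the normalized map $F\mapsto \frac{1}{\sqrt{|K|}}\xi(F)$ is an isometry.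
   Context: All representations are unitary, on finite-dimensional complex inner product spaces (inner products are conjugate-linear in the second argument). For such a space $W$, $\mathrm{End}(W)$ has the scalar product $\langle T_1,T_2\rangle=\frac{1}{\dim W}\mathrm{tr}(T_2^*T_1)$, and $\mathrm{End}_G(W)$ (the operators commuting with the $G$-action) inherits it by restriction; $\mathrm{End}_G(W)$ is a $*$-algebra under composition and adjoint. The induced representation space is $\mathrm{Ind}_K^GV=\{f:G\to V:\ f(gk)=\theta(k^{-1})f(g)\ \forall g\in G,k\in K\}$, with $[\lambda(g)f](g')=f(g^{-1}g')$ and $\langle f_1,f_2\rangle=\frac{1}{|K|}\sum_{g\in G}\langle f_1(g),f_2(g)\rangle_V$. $\widetilde{\mathcal H}(G,K,\theta)$ is the set of all $F:G\to\mathrm{End}(V)$ such that $F(k_1gk_2)=\theta(k_2^{-1})F(g)\theta(k_1^{-1})$ for all $g\in G$, $k_1,k_2\in K$. It is a unital $*$-algebra with product $[F_1*F_2](g)=\sum_{h\in G}F_1(h^{-1}g)F_2(h)$, involution $F^*(g)=[F(g^{-1})]^*$, and scalar product $\langle F_1,F_2\rangle_{\widetilde{\mathcal H}(G,K,\theta)}=\sum_{g\in G}\langle F_1(g),F_2(g)\rangle_{\mathrm{End}(V)}$. *)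

theory Defs
  imports Complex_Main "HOL-Library.Function_Algebras" "HOL-Algebra.QuotRing" "HOL-Algebra.Module"
begin

text \<open>
  Every vector space below is a linear subspace, given by its carrier, of an ambient complex
  vector space; sums, zero and multiples are those of the ambient space, pointwise for spaces of
  functions. A function that is only meaningful on a set (a linear operator on the carrier \<open>W\<close>, a
  function on the group) is made canonical by requiring that it be \<open>0\<close> outside this set.
  Thus equality of such functions is equality on the set, and operators compose by \<open>(\<circ>)\<close>.
\<close>

section \<open>Finite-dimensional complex inner product spaces\<close>

record 'w cinner_space = "'w partial_object" +
  cscale :: "complex \<Rightarrow> 'w \<Rightarrow> 'w"
  cinner :: "'w \<Rightarrow> 'w \<Rightarrow> complex"

locale fin_dim_cinner_space =
  vector_space "cscale W" for W :: "('w::ab_group_add) cinner_space" +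
  assumes carrier_subspace: "subspace (carrier W)"
    and carrier_finite_dim: "\<exists>B. finite B \<and> span B = carrier W"
    and cinner_add_left:
      "\<lbrakk>x \<in> carrier W; y \<in> carrier W; z \<in> carrier W\<rbrakk>
        \<Longrightarrow> cinner W (x + y) z = cinner W x z + cinner W y z"
    and cinner_scale_left:
      "\<lbrakk>x \<in> carrier W; y \<in> carrier W\<rbrakk> \<Longrightarrow> cinner W (cscale W c x) y = c * cinner W x y"
    and cinner_commute:
      "\<lbrakk>x \<in> carrier W; y \<in> carrier W\<rbrakk> \<Longrightarrow> cinner W y x = cnj (cinner W x y)"
    and cinner_nonneg: "x \<in> carrier W \<Longrightarrow> 0 \<le> Re (cinner W x x)"
    and cinner_definite: "\<lbrakk>x \<in> carrier W; cinner W x x = 0\<rbrakk> \<Longrightarrow> x = 0"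

definition endos :: "('w::ab_group_add) cinner_space \<Rightarrow> ('w \<Rightarrow> 'w) set" where
  "endos W = {T. (\<forall>x. x \<notin> carrier W \<longrightarrow> T x = 0) \<and>
     (\<forall>x\<in>carrier W. T x \<in> carrier W) \<and>
     (\<forall>x\<in>carrier W. \<forall>y\<in>carrier W. T (x + y) = T x + T y) \<and>
     (\<forall>c. \<forall>x\<in>carrier W. T (cscale W c x) = cscale W c (T x))}"

definition id_endo :: "('w::ab_group_add) cinner_space \<Rightarrow> 'w \<Rightarrow> 'w" where
  "id_endo W = (\<lambda>x. if x \<in> carrier W then x else 0)"

definition scale_endo ::
  "('w::ab_group_add) cinner_space \<Rightarrow> complex \<Rightarrow> ('w \<Rightarrow> 'w) \<Rightarrow> 'w \<Rightarrow> 'w" where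
  "scale_endo W c T = (\<lambda>x. cscale W c (T x))"

definition adj_endo :: "('w::ab_group_add) cinner_space \<Rightarrow> ('w \<Rightarrow> 'w) \<Rightarrow> 'w \<Rightarrow> 'w" where
  "adj_endo W T = (THE S. S \<in> endos W \<and>
     (\<forall>x\<in>carrier W. \<forall>y\<in>carrier W. cinner W (T x) y = cinner W x (S y)))"

text \<open>The sum of the diagonal entries of the matrix of \<open>T\<close> in some basis of \<open>W\<close>.\<close>

definition trace_endo :: "('w::ab_group_add) cinner_space \<Rightarrow> ('w \<Rightarrow> 'w) \<Rightarrow> complex" where
  "trace_endo W T =
     (let B = (SOME B. \<not> Modules.module.dependent (cscale W) B \<and>
                       Modules.module.span (cscale W) B = carrier W)
      in \<Sum>b\<in>B. Modules.module.representation (cscale W) B (T b) b)"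

definition endo_inner ::
  "('w::ab_group_add) cinner_space \<Rightarrow> ('w \<Rightarrow> 'w) \<Rightarrow> ('w \<Rightarrow> 'w) \<Rightarrow> complex" where
  "endo_inner W T\<^sub>1 T\<^sub>2 =
     1 / of_nat (vector_space.dim (cscale W) (carrier W)) * trace_endo W (adj_endo W T\<^sub>2 \<circ> T\<^sub>1)"


section \<open>Unital \<open>*\<close>-algebras over the complex numbers\<close>

definition complex_ring :: "complex ring" where
  "complex_ring = \<lparr>carrier = UNIV, monoid.mult = (*), one = 1, zero = 0, add = (+)\<rparr>"

record 'b star_alg = "(complex, 'b) module" +
  star :: "'b \<Rightarrow> 'b"

locale star_algebra = ring A + Module.module complex_ring A
  for A :: "'b star_alg" (structure) +
  assumes smult_mult_left:
      "\<lbrakk>x \<in> carrier A; y \<in> carrier A\<rbrakk> \<Longrightarrow> (c \<odot> x) \<otimes> y = c \<odot> (x \<otimes> y)"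
    and smult_mult_right:
      "\<lbrakk>x \<in> carrier A; y \<in> carrier A\<rbrakk> \<Longrightarrow> x \<otimes> (c \<odot> y) = c \<odot> (x \<otimes> y)"
    and star_closed: "x \<in> carrier A \<Longrightarrow> star A x \<in> carrier A"
    and star_star: "x \<in> carrier A \<Longrightarrow> star A (star A x) = x"
    and star_add:
      "\<lbrakk>x \<in> carrier A; y \<in> carrier A\<rbrakk> \<Longrightarrow> star A (x \<oplus> y) = star A x \<oplus> star A y"
    and star_smult: "x \<in> carrier A \<Longrightarrow> star A (c \<odot> x) = cnj c \<odot> star A x"
    and star_mult:
      "\<lbrakk>x \<in> carrier A; y \<in> carrier A\<rbrakk> \<Longrightarrow> star A (x \<otimes> y) = star A y \<otimes> star A x"

definition star_isomorphism :: "'a star_alg \<Rightarrow> 'b star_alg \<Rightarrow> ('a \<Rightarrow> 'b) \<Rightarrow> bool" where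
  "star_isomorphism A B h \<longleftrightarrow> star_algebra A \<and> star_algebra B \<and> h \<in> ring_iso A B \<and>
     (\<forall>c. \<forall>x\<in>carrier A. h (c \<odot>\<^bsub>A\<^esub> x) = c \<odot>\<^bsub>B\<^esub> h x) \<and>
     (\<forall>x\<in>carrier A. h (star A x) = star B (h x))"


section \<open>Unitary representations and their commutants\<close>

text \<open>The values of \<open>\<rho>\<close> outside the carrier of \<open>H\<close> are irrelevant.\<close>

definition unitary_rep ::
  "'g monoid \<Rightarrow> ('w::ab_group_add) cinner_space \<Rightarrow> ('g \<Rightarrow> 'w \<Rightarrow> 'w) \<Rightarrow> bool" where
  "unitary_rep H W \<rho> \<longleftrightarrow>
     (\<forall>g\<in>carrier H. \<rho> g \<in> endos W) \<and>
     \<rho> \<one>\<^bsub>H\<^esub> = id_endo W \<and>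
     (\<forall>g\<in>carrier H. \<forall>h\<in>carrier H. \<rho> (g \<otimes>\<^bsub>H\<^esub> h) = \<rho> g \<circ> \<rho> h) \<and>
     (\<forall>g\<in>carrier H. \<forall>x\<in>carrier W. \<forall>y\<in>carrier W. cinner W (\<rho> g x) (\<rho> g y) = cinner W x y)"

definition commutant_algebra ::
  "'g monoid \<Rightarrow> ('w::ab_group_add) cinner_space \<Rightarrow> ('g \<Rightarrow> 'w \<Rightarrow> 'w) \<Rightarrow> ('w \<Rightarrow> 'w) star_alg" where
  "commutant_algebra H W \<rho> =
     \<lparr>carrier = {T \<in> endos W. \<forall>g\<in>carrier H. T \<circ> \<rho> g = \<rho> g \<circ> T},
      monoid.mult = (\<circ>), one = id_endo W, zero = 0, add = (+),
      smult = scale_endo W, star = adj_endo W\<rparr>"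


section \<open>The induced representation\<close>

definition Ind_space ::
  "'g monoid \<Rightarrow> 'g set \<Rightarrow> ('v::ab_group_add) cinner_space \<Rightarrow> ('g \<Rightarrow> 'v \<Rightarrow> 'v)
    \<Rightarrow> ('g \<Rightarrow> 'v) cinner_space" where
  "Ind_space G K V \<theta> =
     \<lparr>carrier = {f. (\<forall>g. g \<notin> carrier G \<longrightarrow> f g = 0) \<and>
                    (\<forall>g\<in>carrier G. f g \<in> carrier V) \<and>
                    (\<forall>g\<in>carrier G. \<forall>k\<in>K. f (g \<otimes>\<^bsub>G\<^esub> k) = \<theta> (inv\<^bsub>G\<^esub> k) (f g))},
      cscale = (\<lambda>c f g. cscale V c (f g)),
      cinner = (\<lambda>f\<^sub>1 f\<^sub>2. 1 / of_nat (card K) * (\<Sum>g\<in>carrier G. cinner V (f\<^sub>1 g) (f\<^sub>2 g)))\<rparr>"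

definition Ind_rep ::
  "'g monoid \<Rightarrow> 'g set \<Rightarrow> ('v::ab_group_add) cinner_space \<Rightarrow> ('g \<Rightarrow> 'v \<Rightarrow> 'v)
    \<Rightarrow> 'g \<Rightarrow> ('g \<Rightarrow> 'v) \<Rightarrow> 'g \<Rightarrow> 'v" where
  "Ind_rep G K V \<theta> g f =
     (if f \<in> carrier (Ind_space G K V \<theta>)
      then (\<lambda>g'. if g' \<in> carrier G then f (inv\<^bsub>G\<^esub> g \<otimes>\<^bsub>G\<^esub> g') else 0)
      else 0)"

abbreviation End_G_Ind ::
  "'g monoid \<Rightarrow> 'g set \<Rightarrow> ('v::ab_group_add) cinner_space \<Rightarrow> ('g \<Rightarrow> 'v \<Rightarrow> 'v)
    \<Rightarrow> (('g \<Rightarrow> 'v) \<Rightarrow> ('g \<Rightarrow> 'v)) star_alg" where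
  "End_G_Ind G K V \<theta> \<equiv> commutant_algebra G (Ind_space G K V \<theta>) (Ind_rep G K V \<theta>)"


section \<open>The Hecke algebra\<close>

text \<open>The unit is the function supported on \<open>K\<close> with \<open>k \<mapsto> \<theta>(k\<^sup>-\<^sup>1) / |K|\<close>.\<close>

definition Hecke_algebra ::
  "'g monoid \<Rightarrow> 'g set \<Rightarrow> ('v::ab_group_add) cinner_space \<Rightarrow> ('g \<Rightarrow> 'v \<Rightarrow> 'v)
    \<Rightarrow> ('g \<Rightarrow> 'v \<Rightarrow> 'v) star_alg" where
  "Hecke_algebra G K V \<theta> =
     \<lparr>carrier = {F. (\<forall>g. g \<notin> carrier G \<longrightarrow> F g = 0) \<and>
                    (\<forall>g\<in>carrier G. F g \<in> endos V) \<and>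
                    (\<forall>g\<in>carrier G. \<forall>k\<^sub>1\<in>K. \<forall>k\<^sub>2\<in>K.
                       F (k\<^sub>1 \<otimes>\<^bsub>G\<^esub> g \<otimes>\<^bsub>G\<^esub> k\<^sub>2) = \<theta> (inv\<^bsub>G\<^esub> k\<^sub>2) \<circ> F g \<circ> \<theta> (inv\<^bsub>G\<^esub> k\<^sub>1))},
      monoid.mult = (\<lambda>F\<^sub>1 F\<^sub>2 g. if g \<in> carrier G
                         then \<Sum>h\<in>carrier G. F\<^sub>1 (inv\<^bsub>G\<^esub> h \<otimes>\<^bsub>G\<^esub> g) \<circ> F\<^sub>2 h else 0),
      one = (\<lambda>g. if g \<in> K then scale_endo V (1 / of_nat (card K)) (\<theta> (inv\<^bsub>G\<^esub> g)) else 0),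
      zero = 0,
      add = (+),
      smult = (\<lambda>c F g. scale_endo V c (F g)),
      star = (\<lambda>F g. if g \<in> carrier G then adj_endo V (F (inv\<^bsub>G\<^esub> g)) else 0)\<rparr>"

definition Hecke_inner ::
  "'g monoid \<Rightarrow> ('v::ab_group_add) cinner_space
    \<Rightarrow> ('g \<Rightarrow> 'v \<Rightarrow> 'v) \<Rightarrow> ('g \<Rightarrow> 'v \<Rightarrow> 'v) \<Rightarrow> complex" where
  "Hecke_inner G V F\<^sub>1 F\<^sub>2 = (\<Sum>g\<in>carrier G. endo_inner V (F\<^sub>1 g) (F\<^sub>2 g))"

definition Hecke_xi ::
  "'g monoid \<Rightarrow> 'g set \<Rightarrow> ('v::ab_group_add) cinner_space \<Rightarrow> ('g \<Rightarrow> 'v \<Rightarrow> 'v)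
    \<Rightarrow> ('g \<Rightarrow> 'v \<Rightarrow> 'v) \<Rightarrow> ('g \<Rightarrow> 'v) \<Rightarrow> 'g \<Rightarrow> 'v" where
  "Hecke_xi G K V \<theta> F f =
     (if f \<in> carrier (Ind_space G K V \<theta>)
      then (\<lambda>g. if g \<in> carrier G
                then \<Sum>h\<in>carrier G. F (inv\<^bsub>G\<^esub> h \<otimes>\<^bsub>G\<^esub> g) (f h) else 0)
      else 0)"

end

theory Submission
  imports Defs
begin

text \<open>
  For \<open>v \<in> V\<close> let \<open>\<delta>\<^sub>v \<in> Ind\<close> be supported on \<open>K\<close> with \<open>\<delta>\<^sub>v(k) = \<theta>(k\<^sup>-\<^sup>1)v / |K|\<close>. Every
  \<open>f\<close> in the induced space is the sum over \<open>h\<close> of the translates \<open>\<lambda>(h)\<delta>\<^sub>v\<close> with \<open>v = f(h)\<close>, and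
  \<open>F(g)v = [\<xi>(F)\<delta>\<^sub>v](g)\<close>. Hence \<open>T \<mapsto> (g \<mapsto> (v \<mapsto> (T\<delta>\<^sub>v)(g)))\<close> inverts \<open>\<xi>\<close> on the
  commutant. Each operation of the Hecke algebra is the pullback of the corresponding operation of
  the commutant along this bijection, so the axioms of a \<open>*\<close>-algebra carry over as well. For an
  orthonormal basis \<open>E\<close> of \<open>V\<close> the \<open>\<lambda>(g)\<delta>\<^sub>e\<close> span the induced space with coefficient functionals
  \<open>f \<mapsto> \<langle>f(g), e\<rangle>\<close>, whence \<open>tr \<xi>(F) = |G| tr F(1)\<close>. The unit gives the dimension of the induced
  space and \<open>F\<^sub>2\<^sup>* * F\<^sub>1\<close> gives the scalar products.
\<close>

section \<open>Endomorphisms, adjoints and traces\<close>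

lemma sum_fun_apply: "(\<Sum>i\<in>I. f i) x = (\<Sum>i\<in>I. f i x)"
  for f :: "'i \<Rightarrow> 'a \<Rightarrow> 'b::comm_monoid_add"
  by (induction I rule: infinite_finite_induct) auto

context fin_dim_cinner_space
begin

abbreviation scale_syntax (infixr "*\<^sub>W" 75) where "c *\<^sub>W x \<equiv> cscale W c x"
abbreviation inner_syntax ("\<langle>_, _\<rangle>") where "\<langle>x, y\<rangle> \<equiv> cinner W x y"

section \<open>Closure of the carrier and sesquilinearity\<close>

lemma zero_closed [simp]: "0 \<in> carrier W"
  using carrier_subspace by (rule subspace_0)

lemma add_closed [simp]: "x \<in> carrier W \<Longrightarrow> y \<in> carrier W \<Longrightarrow> x + y \<in> carrier W"
  using carrier_subspace by (rule subspace_add)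

lemma diff_closed [simp]: "x \<in> carrier W \<Longrightarrow> y \<in> carrier W \<Longrightarrow> x - y \<in> carrier W"
  using carrier_subspace by (rule subspace_diff)

lemma cscale_closed [simp]: "x \<in> carrier W \<Longrightarrow> c *\<^sub>W x \<in> carrier W"
  using carrier_subspace by (rule subspace_scale)

lemma sum_closed: "(\<And>i. i \<in> I \<Longrightarrow> f i \<in> carrier W) \<Longrightarrow> sum f I \<in> carrier W"
  using carrier_subspace by (rule subspace_sum)

lemma span_closed: "B \<subseteq> carrier W \<Longrightarrow> span B \<subseteq> carrier W"
  using carrier_subspace by (simp add: span_minimal)

lemma cinner_zero_left [simp]: "y \<in> carrier W \<Longrightarrow> \<langle>0, y\<rangle> = 0"
  using cinner_scale_left[of 0 y 0] by simp

lemma cinner_zero_right [simp]: "y \<in> carrier W \<Longrightarrow> \<langle>y, 0\<rangle> = 0"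
  using cinner_commute[of 0 y] by simp

lemma cinner_add_right:
  "x \<in> carrier W \<Longrightarrow> y \<in> carrier W \<Longrightarrow> z \<in> carrier W \<Longrightarrow> \<langle>x, y + z\<rangle> = \<langle>x, y\<rangle> + \<langle>x, z\<rangle>"
  by (metis add_closed cinner_add_left cinner_commute complex_cnj_add)

lemma cinner_scale_right:
  "x \<in> carrier W \<Longrightarrow> y \<in> carrier W \<Longrightarrow> \<langle>x, c *\<^sub>W y\<rangle> = cnj c * \<langle>x, y\<rangle>"
  by (metis cscale_closed cinner_scale_left cinner_commute complex_cnj_mult)

lemma cinner_diff_left:
  "x \<in> carrier W \<Longrightarrow> y \<in> carrier W \<Longrightarrow> z \<in> carrier W \<Longrightarrow> \<langle>x - y, z\<rangle> = \<langle>x, z\<rangle> - \<langle>y, z\<rangle>"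
  using cinner_add_left[of "x - y" y z] by simp

lemma cinner_sum_left:
  assumes "\<And>i. i \<in> I \<Longrightarrow> f i \<in> carrier W" and "z \<in> carrier W"
  shows "\<langle>sum f I, z\<rangle> = (\<Sum>i\<in>I. \<langle>f i, z\<rangle>)"
  using assms
  by (induction I rule: infinite_finite_induct) (auto simp: cinner_add_left sum_closed)

lemma cinner_sum_right:
  assumes "\<And>i. i \<in> I \<Longrightarrow> f i \<in> carrier W" and "z \<in> carrier W"
  shows "\<langle>z, sum f I\<rangle> = (\<Sum>i\<in>I. \<langle>z, f i\<rangle>)"
  using assms
  by (induction I rule: infinite_finite_induct) (auto simp: cinner_add_right sum_closed)

text \<open>The difference \<open>x - y\<close> is orthogonal to the whole carrier, hence to itself,
  and definiteness applies. Adjoints are compared in this way.\<close>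

lemma cinner_eqI:
  assumes "x \<in> carrier W" "y \<in> carrier W"
    and eq: "\<And>z. z \<in> carrier W \<Longrightarrow> \<langle>z, x\<rangle> = \<langle>z, y\<rangle>"
  shows "x = y"
proof -
  have "\<langle>z, x - y\<rangle> = 0" if "z \<in> carrier W" for z
    using cinner_add_right[of z "x - y" y] eq[OF that] that assms by simp
  then show ?thesis
    using cinner_definite[of "x - y"] assms by simp
qed

section \<open>Orthonormal bases\<close>

definition orthonormal :: "'w set \<Rightarrow> bool" where
  "orthonormal E \<longleftrightarrow> finite E \<and> E \<subseteq> carrier W \<and>
     (\<forall>e\<in>E. \<forall>e'\<in>E. \<langle>e, e'\<rangle> = (if e = e' then 1 else 0))"

text \<open>Pairing any expression of \<open>x\<close> as a combination of \<open>E\<close> with a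
  member \<open>e\<close> isolates the coefficient of \<open>e\<close>, so the coefficients are
  forced.\<close>

lemma orthonormal_expansion:
  assumes E: "orthonormal E" and x: "x \<in> span E"
  shows "x = (\<Sum>e\<in>E. \<langle>x, e\<rangle> *\<^sub>W e)"
proof -
  have fin: "finite E" and sub: "E \<subseteq> carrier W" using E by (auto simp: orthonormal_def)
  obtain u where u: "x = (\<Sum>e\<in>E. u e *\<^sub>W e)"
    using x fin by (auto simp: span_finite)
  have "\<langle>x, e\<rangle> = u e" if e: "e \<in> E" for e
  proof -
    have "\<langle>x, e\<rangle> = (\<Sum>e'\<in>E. u e' * \<langle>e', e\<rangle>)"
      using sub e by (auto simp: u cinner_sum_left subset_iff cinner_scale_left intro!: sum.cong)
    also have "\<dots> = (\<Sum>e'\<in>E. if e' = e then u e' else 0)"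
      using E e by (intro sum.cong) (auto simp: orthonormal_def)
    finally show ?thesis using fin e by simp
  qed
  then have "(\<Sum>e\<in>E. \<langle>x, e\<rangle> *\<^sub>W e) = (\<Sum>e\<in>E. u e *\<^sub>W e)"
    by (intro sum.cong) auto
  with u show ?thesis by (metis (no_types))
qed

text \<open>Induction on \<open>B\<close>: subtract from the new vector its projection
  \<open>p\<close> to the previous span and normalise the remainder. If the remainder is zero, the
  new vector lies in the old span and is dropped.\<close>

lemma gram_schmidt:
  assumes "finite B" "B \<subseteq> carrier W"
  shows "\<exists>E. orthonormal E \<and> span E = span B"
  using assms
proof (induction B rule: finite_induct)
  case empty
  show ?case by (rule exI[of _ "{}"]) (simp add: orthonormal_def)
next
  case (insert b B)
  then obtain E where E: "orthonormal E" and sp: "span E = span B" by auto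
  have fin: "finite E" and sub: "E \<subseteq> carrier W" using E by (auto simp: orthonormal_def)
  have b: "b \<in> carrier W" using insert by simp
  define p where "p = (\<Sum>e\<in>E. \<langle>b, e\<rangle> *\<^sub>W e)"
  define y where "y = b - p"
  have pE: "p \<in> span E" by (auto simp: p_def intro: span_sum span_scale span_base)
  have pW: "p \<in> carrier W" using pE sub span_closed by auto
  have yW: "y \<in> carrier W" using b pW by (simp add: y_def)
  have orth: "\<langle>y, e\<rangle> = 0" if "e \<in> E" for e
  proof -
    have "\<langle>p, e\<rangle> = (\<Sum>e'\<in>E. \<langle>b, e'\<rangle> * \<langle>e', e\<rangle>)"
      using sub that by (auto simp: p_def cinner_sum_left subset_iff cinner_scale_left intro!: sum.cong)
    also have "\<dots> = (\<Sum>e'\<in>E. if e' = e then \<langle>b, e'\<rangle> else 0)"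
      using E that by (intro sum.cong) (auto simp: orthonormal_def)
    finally show ?thesis using fin that sub b pW by (auto simp: y_def cinner_diff_left)
  qed
  show ?case
  proof (cases "y = 0")
    case True
    then have "b \<in> span B" using pE sp by (simp add: y_def)
    then show ?thesis using E sp span_redundant by metis
  next
    case False
    define r where "r = Re \<langle>y, y\<rangle>"
    \<comment> \<open>By conjugate symmetry the imaginary part of this number is its own
      negative.\<close>
    have yy: "\<langle>y, y\<rangle> = of_real r"
      using arg_cong[OF cinner_commute[OF yW yW], of Im] by (simp add: complex_eq_iff r_def)
    have "r \<noteq> 0" using cinner_definite[OF yW] yy False by auto
    then have r: "r > 0" using cinner_nonneg[OF yW] by (simp add: r_def)
    define c where "c = complex_of_real (1 / sqrt r)"
    have c0: "c \<noteq> 0" using r by (simp add: c_def)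
    have norm1: "\<langle>c *\<^sub>W y, c *\<^sub>W y\<rangle> = 1"
    proof -
      have "\<langle>c *\<^sub>W y, c *\<^sub>W y\<rangle> = c * cnj c * of_real r"
        by (simp only: yW cscale_closed cinner_scale_left cinner_scale_right yy ac_simps)
      also have "\<dots> = complex_of_real (1 / sqrt r * (1 / sqrt r) * r)"
        unfolding c_def by (simp only: complex_cnj_complex_of_real of_real_mult)
      also have "1 / sqrt r * (1 / sqrt r) * r = 1" using r by (simp add: field_simps)
      finally show ?thesis by (simp only: of_real_1)
    qed
    have "\<langle>c *\<^sub>W y, e\<rangle> = 0 \<and> \<langle>e, c *\<^sub>W y\<rangle> = 0" if "e \<in> E" for e
      using orth[OF that] that sub yW cinner_commute[of y e]
      by (auto simp: cinner_scale_left cinner_scale_right)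
    then have "orthonormal (insert (c *\<^sub>W y) E)"
      using E norm1 yW by (auto simp: orthonormal_def)
    moreover have "span (insert (c *\<^sub>W y) E) = span (insert b B)"
    proof -
      let ?y = "c *\<^sub>W y"
      have p1: "p \<in> span (insert b E)" and p2: "p \<in> span (insert ?y E)"
        by (rule subsetD[OF span_mono[OF subset_insertI] pE])+
      have "?y \<in> span (insert b E)"
        unfolding y_def using p1 by (intro span_scale span_diff) (simp_all add: span_base)
      then have "span (insert ?y E) \<subseteq> span (insert b E)"
        by (intro span_minimal) (auto intro: span_base)
      \<comment> \<open>Undoing the normalisation recovers \<open>b\<close>, so nothing is lost from
        the span.\<close>
      moreover have "b = (1 / c) *\<^sub>W ?y + p" using c0 by (simp add: y_def)
      then have "b \<in> span (insert ?y E)"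
        using p2 by (metis span_add span_scale span_base insertI1)
      then have "span (insert b E) \<subseteq> span (insert ?y E)"
        by (intro span_minimal) (auto intro: span_base)
      moreover have "span (insert b E) = span (insert b B)"
        using sp by (simp only: span_insert)
      ultimately show ?thesis by blast
    qed
    ultimately show ?thesis by blast
  qed
qed

lemma orthonormal_basis_exists:
  obtains E where "orthonormal E" "span E = carrier W"
proof -
  obtain B where "finite B" "span B = carrier W" using carrier_finite_dim by blast
  moreover from this have "B \<subseteq> carrier W" using span_superset by blast
  ultimately show thesis using gram_schmidt that by metis
qed

section \<open>Linear operators on the carrier and their adjoints\<close>

lemma endos_closed [simp]: "T \<in> endos W \<Longrightarrow> x \<in> carrier W \<Longrightarrow> T x \<in> carrier W"
  unfolding endos_def by blast

lemma endos_outside: "T \<in> endos W \<Longrightarrow> x \<notin> carrier W \<Longrightarrow> T x = 0"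
  unfolding endos_def by blast

lemma endos_add: "T \<in> endos W \<Longrightarrow> x \<in> carrier W \<Longrightarrow> y \<in> carrier W \<Longrightarrow> T (x + y) = T x + T y"
  unfolding endos_def by blast

lemma endos_scale: "T \<in> endos W \<Longrightarrow> x \<in> carrier W \<Longrightarrow> T (c *\<^sub>W x) = c *\<^sub>W T x"
  unfolding endos_def by blast

lemma endos_zero [simp]: "T \<in> endos W \<Longrightarrow> T 0 = 0"
  using endos_scale[of T 0 0] by simp

lemma endos_sum:
  assumes "T \<in> endos W" "\<And>i. i \<in> I \<Longrightarrow> f i \<in> carrier W"
  shows "T (sum f I) = (\<Sum>i\<in>I. T (f i))"
  using assms(2)
  by (induction I rule: infinite_finite_induct) (auto simp: endos_add sum_closed assms(1))

text \<open>Outside the carrier the canonical value is \<open>0\<close>, which lies in the carrier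
  as well.\<close>

lemma endos_range [simp]: "T \<in> endos W \<Longrightarrow> T x \<in> carrier W"
  by (cases "x \<in> carrier W") (auto simp: endos_outside)

lemma endosI:
  assumes "\<And>x. x \<notin> carrier W \<Longrightarrow> T x = 0" "\<And>x. x \<in> carrier W \<Longrightarrow> T x \<in> carrier W"
    "\<And>x y. x \<in> carrier W \<Longrightarrow> y \<in> carrier W \<Longrightarrow> T (x + y) = T x + T y"
    "\<And>c x. x \<in> carrier W \<Longrightarrow> T (c *\<^sub>W x) = c *\<^sub>W T x"
  shows "T \<in> endos W"
  using assms unfolding endos_def by (intro CollectI conjI ballI allI impI)

lemma endos_eqI:
  assumes "S \<in> endos W" "T \<in> endos W" "\<And>x. x \<in> carrier W \<Longrightarrow> S x = T x"
  shows "S = T"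
proof
  show "S x = T x" for x
    using assms by (cases "x \<in> carrier W") (simp_all add: endos_outside)
qed

lemma zero_endo [simp]: "0 \<in> endos W"
  by (rule endosI) auto

lemma add_endo [simp]: "S \<in> endos W \<Longrightarrow> T \<in> endos W \<Longrightarrow> S + T \<in> endos W"
  by (rule endosI) (simp_all add: endos_add endos_scale endos_outside scale_right_distrib)

lemma sum_endo: "(\<And>i. i \<in> I \<Longrightarrow> f i \<in> endos W) \<Longrightarrow> sum f I \<in> endos W"
  by (induction I rule: infinite_finite_induct) auto

lemma scale_endo_apply [simp]: "scale_endo W c T x = c *\<^sub>W T x"
  by (simp add: scale_endo_def)

lemma scale_endo_closed [simp]: "T \<in> endos W \<Longrightarrow> scale_endo W c T \<in> endos W"
  by (rule endosI) (auto simp: endos_add endos_scale endos_outside scale_right_distrib mult.commute)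

lemma comp_endo [simp]: "S \<in> endos W \<Longrightarrow> T \<in> endos W \<Longrightarrow> S \<circ> T \<in> endos W"
  by (rule endosI) (auto simp: endos_add endos_scale endos_outside)

lemma id_endo_apply [simp]: "x \<in> carrier W \<Longrightarrow> id_endo W x = x"
  by (simp add: id_endo_def)

lemma id_endo_closed [simp]: "id_endo W \<in> endos W"
  by (rule endosI) (auto simp: id_endo_def)

text \<open>Two candidates have equal pairings with every vector and so coincide. The definite
  description can thus be evaluated by checking the adjoint identity for one operator.\<close>

lemma adj_endo_eqI:
  assumes S: "S \<in> endos W"
    and adj: "\<And>x y. x \<in> carrier W \<Longrightarrow> y \<in> carrier W \<Longrightarrow> \<langle>T x, y\<rangle> = \<langle>x, S y\<rangle>"
  shows "adj_endo W T = S"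
  unfolding adj_endo_def
proof (rule the_equality)
  fix S' assume S': "S' \<in> endos W \<and> (\<forall>x\<in>carrier W. \<forall>y\<in>carrier W. \<langle>T x, y\<rangle> = \<langle>x, S' y\<rangle>)"
  show "S' = S"
  proof (rule endos_eqI)
    fix y assume y: "y \<in> carrier W"
    show "S' y = S y"
      by (rule cinner_eqI) (use S S' y adj in auto)
  qed (use S S' in auto)
qed (use assms in auto)

lemma adj_endo_exists:
  assumes T: "T \<in> endos W"
  shows "\<exists>S\<in>endos W. \<forall>x\<in>carrier W. \<forall>y\<in>carrier W. \<langle>T x, y\<rangle> = \<langle>x, S y\<rangle>"
proof -
  obtain E where E: "orthonormal E" and sp: "span E = carrier W" by (rule orthonormal_basis_exists)
  have sub: "e \<in> carrier W" if "e \<in> E" for e using E that by (auto simp: orthonormal_def)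
  \<comment> \<open>The adjoint identity forces the coefficient of \<open>S y\<close> along
    \<open>e\<close>, namely
    \<open>\<langle>S y, e\<rangle> = \<langle>y, T e\<rangle>\<close>.\<close>
  define S where "S y = (if y \<in> carrier W then \<Sum>e\<in>E. \<langle>y, T e\<rangle> *\<^sub>W e else 0)" for y
  have "S \<in> endos W"
    by (rule endosI)
      (auto simp: S_def sum_closed sub T cinner_add_left cinner_scale_left scale_left_distrib
         sum.distrib scale_sum_right intro!: sum.cong)
  moreover have "\<langle>T x, y\<rangle> = \<langle>x, S y\<rangle>" if x: "x \<in> carrier W" and y: "y \<in> carrier W" for x y
  proof -
    have "T x = T (\<Sum>e\<in>E. \<langle>x, e\<rangle> *\<^sub>W e)"
      by (rule arg_cong[OF orthonormal_expansion[OF E]]) (simp add: x sp)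
    also have "\<dots> = (\<Sum>e\<in>E. \<langle>x, e\<rangle> *\<^sub>W T e)"
      by (simp add: endos_sum T sub endos_scale)
    finally have "\<langle>T x, y\<rangle> = (\<Sum>e\<in>E. \<langle>x, e\<rangle> * \<langle>T e, y\<rangle>)"
      using T y sub by (simp add: cinner_sum_left cinner_scale_left)
    also have "\<dots> = (\<Sum>e\<in>E. \<langle>x, \<langle>y, T e\<rangle> *\<^sub>W e\<rangle>)"
    proof (rule sum.cong)
      fix e assume "e \<in> E"
      then show "\<langle>x, e\<rangle> * \<langle>T e, y\<rangle> = \<langle>x, \<langle>y, T e\<rangle> *\<^sub>W e\<rangle>"
        using x y sub T cinner_commute[of "T e" y] by (simp add: cinner_scale_right)
    qed simp
    also have "\<dots> = \<langle>x, S y\<rangle>"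
      using x y sub by (simp add: S_def cinner_sum_right)
    finally show ?thesis .
  qed
  ultimately show ?thesis by blast
qed

lemma
  assumes T: "T \<in> endos W"
  shows adj_endo_closed [simp]: "adj_endo W T \<in> endos W"
    and cinner_adj_endo:
      "x \<in> carrier W \<Longrightarrow> y \<in> carrier W \<Longrightarrow> \<langle>x, adj_endo W T y\<rangle> = \<langle>T x, y\<rangle>"
proof -
  obtain S where "S \<in> endos W" "\<And>x y. x \<in> carrier W \<Longrightarrow> y \<in> carrier W \<Longrightarrow> \<langle>T x, y\<rangle> = \<langle>x, S y\<rangle>"
    using adj_endo_exists[OF T] by auto
  then show "adj_endo W T \<in> endos W"
    and "x \<in> carrier W \<Longrightarrow> y \<in> carrier W \<Longrightarrow> \<langle>x, adj_endo W T y\<rangle> = \<langle>T x, y\<rangle>"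
    using adj_endo_eqI[of S T] by auto
qed

lemma cinner_adj_endo_left:
  assumes "T \<in> endos W" "x \<in> carrier W" "y \<in> carrier W"
  shows "\<langle>adj_endo W T x, y\<rangle> = \<langle>x, T y\<rangle>"
  using assms cinner_adj_endo[of T y x] cinner_commute[of "T y" x]
    cinner_commute[of y "adj_endo W T x"] by simp

lemma adj_endo_adj_endo: "T \<in> endos W \<Longrightarrow> adj_endo W (adj_endo W T) = T"
  by (rule adj_endo_eqI) (simp_all add: cinner_adj_endo_left)

lemma adj_endo_add:
  assumes "S \<in> endos W" "T \<in> endos W"
  shows "adj_endo W (S + T) = adj_endo W S + adj_endo W T"
  by (rule adj_endo_eqI) (use assms in \<open>simp_all add: cinner_add_left cinner_add_right cinner_adj_endo\<close>)

lemma adj_endo_scale: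
  assumes "T \<in> endos W"
  shows "adj_endo W (scale_endo W c T) = scale_endo W (cnj c) (adj_endo W T)"
  by (rule adj_endo_eqI) (use assms in \<open>simp_all add: cinner_scale_left cinner_scale_right cinner_adj_endo\<close>)

lemma adj_endo_comp:
  assumes "S \<in> endos W" "T \<in> endos W"
  shows "adj_endo W (S \<circ> T) = adj_endo W T \<circ> adj_endo W S"
  by (rule adj_endo_eqI) (use assms in \<open>simp_all add: cinner_adj_endo\<close>)

section \<open>Traces\<close>

lemma trace_endo_basis:
  obtains B where "independent B" "span B = carrier W" "finite B"
    "\<And>T. trace_endo W T = (\<Sum>b\<in>B. representation B (T b) b)"
proof -
  \<comment> \<open>The basis chosen inside \<open>trace_endo\<close>, the same for every operator.
    It is finite because it is independent and lies in a finitely generated span.\<close>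
  define B where "B = (SOME B. independent B \<and> span B = carrier W)"
  obtain C where "C \<subseteq> carrier W" "independent C" "carrier W \<subseteq> span C"
    using basis_exists[of "carrier W"] .
  then have "independent C \<and> span C = carrier W" using span_closed[of C] by auto
  then have B: "independent B \<and> span B = carrier W" unfolding B_def by (rule someI)
  obtain D where "finite D" "span D = carrier W" using carrier_finite_dim by blast
  then have "finite B" using independent_span_bound[of D B] B span_superset[of B] by auto
  with B show thesis by (intro that[of B]) (auto simp: trace_endo_def B_def Let_def)
qed

text \<open>The family \<open>u\<close> need not be linearly independent. This is used for the induced space, where
  the natural spanning family is indexed by the whole group and not by coset representatives.\<close>

lemma trace_endo_dual_family:
  assumes T: "T \<in> endos W" and u: "\<And>i. i \<in> I \<Longrightarrow> u i \<in> carrier W"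
    and add: "\<And>i x y. i \<in> I \<Longrightarrow> x \<in> carrier W \<Longrightarrow> y \<in> carrier W \<Longrightarrow> \<phi> i (x + y) = \<phi> i x + \<phi> i y"
    and scale: "\<And>i c x. i \<in> I \<Longrightarrow> x \<in> carrier W \<Longrightarrow> \<phi> i (c *\<^sub>W x) = c * \<phi> i x"
    and expansion: "\<And>x. x \<in> carrier W \<Longrightarrow> x = (\<Sum>i\<in>I. \<phi> i x *\<^sub>W u i)"
  shows "trace_endo W T = (\<Sum>i\<in>I. \<phi> i (T (u i)))"
proof -
  obtain B where B: "independent B" "span B = carrier W" "finite B"
    and tr: "\<And>T. trace_endo W T = (\<Sum>b\<in>B. representation B (T b) b)"
    by (rule trace_endo_basis) blast
  have BW: "b \<in> carrier W" if "b \<in> B" for b using B span_base that by blast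
  \<comment> \<open>Expand \<open>T b\<close> through the family \<open>u\<close> before reading off
    its coordinate along \<open>b\<close>.\<close>
  have "representation B (T b) b = (\<Sum>i\<in>I. \<phi> i (T b) * representation B (u i) b)" if "b \<in> B" for b
  proof -
    have "representation B (T b) = representation B (\<Sum>i\<in>I. \<phi> i (T b) *\<^sub>W u i)"
      by (rule arg_cong[OF expansion]) (simp add: T)
    also have "\<dots> = (\<lambda>b'. \<Sum>i\<in>I. representation B (\<phi> i (T b) *\<^sub>W u i) b')"
      using B u by (intro representation_sum) auto
    also have "\<dots> = (\<lambda>b'. \<Sum>i\<in>I. \<phi> i (T b) * representation B (u i) b')"
      using B u by (intro ext sum.cong) (auto simp: representation_scale)
    finally show ?thesis by simp
  qed
  \<comment> \<open>With the sum over \<open>b\<close> innermost, linearity of \<open>T\<close> and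
    \<open>\<phi> i\<close> reassembles \<open>u i\<close> from its coordinates.\<close>
  then have "trace_endo W T = (\<Sum>i\<in>I. \<Sum>b\<in>B. representation B (u i) b * \<phi> i (T b))"
    by (subst sum.swap) (simp add: tr mult.commute)
  also have "\<dots> = (\<Sum>i\<in>I. \<phi> i (T (u i)))"
  proof (rule sum.cong)
    fix i assume i: "i \<in> I"
    have "T (u i) = T (\<Sum>b\<in>B. representation B (u i) b *\<^sub>W b)"
      using B u i by (simp add: sum_representation_eq)
    also have "\<dots> = (\<Sum>b\<in>B. representation B (u i) b *\<^sub>W T b)"
      using T BW by (simp add: endos_sum endos_scale)
    finally have eq: "T (u i) = (\<Sum>b\<in>B. representation B (u i) b *\<^sub>W T b)" .
    \<comment> \<open>Additivity and homogeneity extend to finite sums; for the empty sum,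
      homogeneity with scalar \<open>0\<close> gives the value.\<close>
    have fs: "\<phi> i (\<Sum>b\<in>A. c b *\<^sub>W T b) = (\<Sum>b\<in>A. c b * \<phi> i (T b))" if "finite A" for A c
      using that
    proof (induction A rule: finite_induct)
      case empty
      show ?case using scale[OF i, of 0 0] by simp
    next
      case (insert b A)
      then show ?case using i T by (auto simp: add scale sum_closed)
    qed
    show "(\<Sum>b\<in>B. representation B (u i) b * \<phi> i (T b)) = \<phi> i (T (u i))"
      using fs[OF B(3), of "representation B (u i)"] by (simp add: eq)
  qed simp
  finally show ?thesis .
qed

text \<open>Orthonormal vectors are dual to the functionals obtained by pairing with them. The trace
  is thereby freed from the basis chosen in its definition.\<close>

lemma trace_endo_orthonormal:
  assumes T: "T \<in> endos W" and E: "orthonormal E" "span E = carrier W"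
  shows "trace_endo W T = (\<Sum>e\<in>E. \<langle>T e, e\<rangle>)"
  using E by (intro trace_endo_dual_family[OF T])
    (simp_all add: orthonormal_expansion[symmetric], auto simp: orthonormal_def cinner_add_left cinner_scale_left subset_iff)

text \<open>Later read from right to left: the dimension of the induced space is computed as a
  trace.\<close>

lemma trace_id_endo: "trace_endo W (id_endo W) = of_nat (dim (carrier W))"
proof -
  obtain B where B: "independent B" "span B = carrier W" "finite B"
    and tr: "\<And>T. trace_endo W T = (\<Sum>b\<in>B. representation B (T b) b)"
    by (rule trace_endo_basis) blast
  have "b \<in> carrier W" if "b \<in> B" for b using B span_base that by blast
  then have "trace_endo W (id_endo W) = (\<Sum>b\<in>B. 1)"
    unfolding tr using B(1) by (intro sum.cong) (auto simp: representation_basis)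
  moreover have "dim (carrier W) = card B"
    using dim_span_eq_card_independent[OF B(1)] B(2) by simp
  ultimately show ?thesis by simp
qed

lemma trace_endo_scale:
  assumes "T \<in> endos W"
  shows "trace_endo W (scale_endo W c T) = c * trace_endo W T"
proof -
  obtain E where E: "orthonormal E" "span E = carrier W" by (rule orthonormal_basis_exists)
  have "e \<in> carrier W" if "e \<in> E" for e using E that by (auto simp: orthonormal_def)
  then show ?thesis
    using assms by (simp add: trace_endo_orthonormal[OF _ E] cinner_scale_left sum_distrib_left)
qed

lemma trace_endo_sum:
  assumes "\<And>i. i \<in> I \<Longrightarrow> T i \<in> endos W"
  shows "trace_endo W (\<Sum>i\<in>I. T i) = (\<Sum>i\<in>I. trace_endo W (T i))"
proof -
  obtain E where E: "orthonormal E" "span E = carrier W" by (rule orthonormal_basis_exists)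
  have "e \<in> carrier W" if "e \<in> E" for e using E that by (auto simp: orthonormal_def)
  then show ?thesis
    using assms
    by (simp add: trace_endo_orthonormal[OF _ E] sum_endo sum_fun_apply cinner_sum_left sum.swap[of _ E])
qed

lemma endo_inner_scale:
  assumes S: "S \<in> endos W" and T: "T \<in> endos W"
  shows "endo_inner W (scale_endo W c S) (scale_endo W d T) = c * cnj d * endo_inner W S T"
proof -
  have "adj_endo W (scale_endo W d T) \<circ> scale_endo W c S
      = scale_endo W (c * cnj d) (adj_endo W T \<circ> S)"
    using S T by (auto simp: adj_endo_scale endos_scale fun_eq_iff mult.commute)
  then show ?thesis using S T by (simp add: endo_inner_def trace_endo_scale)
qed

end

section \<open>Unital \<open>*\<close>-algebras\<close>

lemma cring_complex_ring: "cring complex_ring"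
proof (rule cringI)
  show "abelian_group complex_ring"
    by (rule abelian_groupI) (auto simp: complex_ring_def intro: exI[of _ "- x" for x] add.left_inverse)
  show "Group.comm_monoid complex_ring"
    by (rule comm_monoidI) (auto simp: complex_ring_def)
qed (auto simp: complex_ring_def ring_distribs)

text \<open>Flattens the locale hierarchy into elementary axioms, with scalar arithmetic in
  \<open>complex\<close> instead of \<open>complex_ring\<close>.\<close>

lemma star_algebraI:
  fixes A :: "'b star_alg" (structure)
  assumes "abelian_group A" and "Group.monoid A"
    and "\<And>x y z. \<lbrakk>x \<in> carrier A; y \<in> carrier A; z \<in> carrier A\<rbrakk> \<Longrightarrow> (x \<oplus> y) \<otimes> z = x \<otimes> z \<oplus> y \<otimes> z"
    and "\<And>x y z. \<lbrakk>x \<in> carrier A; y \<in> carrier A; z \<in> carrier A\<rbrakk> \<Longrightarrow> z \<otimes> (x \<oplus> y) = z \<otimes> x \<oplus> z \<otimes> y"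
    and "\<And>c x. x \<in> carrier A \<Longrightarrow> c \<odot> x \<in> carrier A"
    and "\<And>c d x. x \<in> carrier A \<Longrightarrow> (c + d) \<odot> x = c \<odot> x \<oplus> d \<odot> x"
    and "\<And>c x y. \<lbrakk>x \<in> carrier A; y \<in> carrier A\<rbrakk> \<Longrightarrow> c \<odot> (x \<oplus> y) = c \<odot> x \<oplus> c \<odot> y"
    and "\<And>c d x. x \<in> carrier A \<Longrightarrow> (c * d) \<odot> x = c \<odot> (d \<odot> x)"
    and "\<And>x. x \<in> carrier A \<Longrightarrow> 1 \<odot> x = x"
    and "\<And>c x y. \<lbrakk>x \<in> carrier A; y \<in> carrier A\<rbrakk> \<Longrightarrow> (c \<odot> x) \<otimes> y = c \<odot> (x \<otimes> y)"
    and "\<And>c x y. \<lbrakk>x \<in> carrier A; y \<in> carrier A\<rbrakk> \<Longrightarrow> x \<otimes> (c \<odot> y) = c \<odot> (x \<otimes> y)"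
    and "\<And>x. x \<in> carrier A \<Longrightarrow> star A x \<in> carrier A"
    and "\<And>x. x \<in> carrier A \<Longrightarrow> star A (star A x) = x"
    and "\<And>x y. \<lbrakk>x \<in> carrier A; y \<in> carrier A\<rbrakk> \<Longrightarrow> star A (x \<oplus> y) = star A x \<oplus> star A y"
    and "\<And>c x. x \<in> carrier A \<Longrightarrow> star A (c \<odot> x) = cnj c \<odot> star A x"
    and "\<And>x y. \<lbrakk>x \<in> carrier A; y \<in> carrier A\<rbrakk> \<Longrightarrow> star A (x \<otimes> y) = star A y \<otimes> star A x"
  shows "star_algebra A"
proof (rule star_algebra.intro)
  show "ring A"
    by (rule ringI) (fact assms)+
  show "Module.module complex_ring A"
    by (rule moduleI[OF cring_complex_ring assms(1)]) (simp_all add: complex_ring_def assms(5-9))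
  show "star_algebra_axioms A"
    by (rule star_algebra_axioms.intro) (fact assms)+
qed

text \<open>Transport of structure: the operations of \<open>A\<close> are pulled back from
  \<open>B\<close> along the mutually inverse maps \<open>h\<close> and \<open>c\<close>, so each
  axiom of \<open>A\<close> is the image under \<open>c\<close> of an axiom of \<open>B\<close>, and
  \<open>h\<close> respects the operations by construction.\<close>

lemma star_isomorphism_transport:
  fixes A :: "'a star_alg" and B :: "'b star_alg"
  assumes B: "star_algebra B"
    and h: "\<And>x. x \<in> carrier A \<Longrightarrow> h x \<in> carrier B" and c: "\<And>y. y \<in> carrier B \<Longrightarrow> c y \<in> carrier A"
    and ch: "\<And>x. x \<in> carrier A \<Longrightarrow> c (h x) = x" and hc: "\<And>y. y \<in> carrier B \<Longrightarrow> h (c y) = y"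
    and mult: "\<And>x y. \<lbrakk>x \<in> carrier A; y \<in> carrier A\<rbrakk> \<Longrightarrow> x \<otimes>\<^bsub>A\<^esub> y = c (h x \<otimes>\<^bsub>B\<^esub> h y)"
    and one: "\<one>\<^bsub>A\<^esub> = c \<one>\<^bsub>B\<^esub>" and zero: "\<zero>\<^bsub>A\<^esub> = c \<zero>\<^bsub>B\<^esub>"
    and add: "\<And>x y. \<lbrakk>x \<in> carrier A; y \<in> carrier A\<rbrakk> \<Longrightarrow> x \<oplus>\<^bsub>A\<^esub> y = c (h x \<oplus>\<^bsub>B\<^esub> h y)"
    and smult: "\<And>a x. x \<in> carrier A \<Longrightarrow> a \<odot>\<^bsub>A\<^esub> x = c (a \<odot>\<^bsub>B\<^esub> h x)"
    and star: "\<And>x. x \<in> carrier A \<Longrightarrow> star A x = c (star B (h x))"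
  shows "star_isomorphism A B h"
proof -
  interpret R: ring B using B by (rule star_algebra.axioms)
  interpret B: star_algebra B by (rule B)
  \<comment> \<open>The module axioms of \<open>B\<close> speak of \<open>complex_ring\<close>; they
    are restated here with ordinary complex arithmetic.\<close>
  have [simp]: "a \<odot>\<^bsub>B\<^esub> y \<in> carrier B" if "y \<in> carrier B" for a y
    using B.smult_closed[of a y] that by (simp add: complex_ring_def)
  have sm1: "(a + b) \<odot>\<^bsub>B\<^esub> y = a \<odot>\<^bsub>B\<^esub> y \<oplus>\<^bsub>B\<^esub> b \<odot>\<^bsub>B\<^esub> y"
    and sm2: "(a * b) \<odot>\<^bsub>B\<^esub> y = a \<odot>\<^bsub>B\<^esub> (b \<odot>\<^bsub>B\<^esub> y)"
    and sm4: "1 \<odot>\<^bsub>B\<^esub> y = y" if "y \<in> carrier B" for a b y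
    using B.smult_l_distr[of a b y] B.smult_assoc1[of a b y] B.smult_one[of y] that
    by (simp_all add: complex_ring_def)
  have sm3: "a \<odot>\<^bsub>B\<^esub> (x \<oplus>\<^bsub>B\<^esub> y) = a \<odot>\<^bsub>B\<^esub> x \<oplus>\<^bsub>B\<^esub> a \<odot>\<^bsub>B\<^esub> y"
    if "x \<in> carrier B" "y \<in> carrier B" for a x y
    using B.smult_r_distr[of a x y] that by (simp add: complex_ring_def)
  \<comment> \<open>As rewrite rules these express every operation of \<open>A\<close> through
    \<open>B\<close> and cancel \<open>h\<close> against \<open>c\<close>. What remains are axioms
    of \<open>B\<close>.\<close>
  note [simp] = h c ch hc mult one zero add smult star B.star_closed
  have "abelian_group A"
  proof (rule abelian_groupI)
    fix x assume x: "x \<in> carrier A"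
    then show "\<exists>y\<in>carrier A. y \<oplus>\<^bsub>A\<^esub> x = \<zero>\<^bsub>A\<^esub>"
      by (intro bexI[of _ "c (\<ominus>\<^bsub>B\<^esub> h x)"]) (simp_all add: R.l_neg)
  qed (simp_all add: R.a_ac)
  moreover have "Group.monoid A"
    by (rule monoidI) (simp_all add: R.m_assoc)
  ultimately have "star_algebra A"
    by (rule star_algebraI)
      (simp_all add: R.l_distr R.r_distr sm1 sm2 sm3 sm4 B.smult_mult_left B.smult_mult_right
        B.star_star B.star_add B.star_smult B.star_mult)
  moreover have "bij_betw h (carrier A) (carrier B)"
    by (rule bij_betw_byWitness[where f' = c]) auto
  then have "h \<in> ring_iso A B"
    by (simp add: ring_iso_def ring_hom_def)
  ultimately show ?thesis
    using B by (simp add: star_isomorphism_def)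
qed

section \<open>The commutant of a unitary representation\<close>

lemma (in fin_dim_cinner_space) star_algebra_commutant:
  assumes H: "group H" and rep: "unitary_rep H W \<rho>"
  shows "star_algebra (commutant_algebra H W \<rho>)"
proof -
  interpret H: group H by (rule H)
  have rho [simp]: "\<rho> g \<in> endos W" if "g \<in> carrier H" for g
    using rep that by (simp add: unitary_rep_def)
  \<comment> \<open>Membership in pointwise form. Off the carrier both compositions vanish, so
    agreement on the carrier is enough.\<close>
  define C where "C T \<longleftrightarrow> T \<in> endos W \<and> (\<forall>g\<in>carrier H. \<forall>x\<in>carrier W. T (\<rho> g x) = \<rho> g (T x))" for T
  have carrier_C: "{T \<in> endos W. \<forall>g\<in>carrier H. T \<circ> \<rho> g = \<rho> g \<circ> T} = {T. C T}"
  proof -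
    have "T \<circ> \<rho> g = \<rho> g \<circ> T \<longleftrightarrow> (\<forall>x\<in>carrier W. T (\<rho> g x) = \<rho> g (T x))"
      if "T \<in> endos W" "g \<in> carrier H" for T g
      using that endos_eqI[of "T \<circ> \<rho> g" "\<rho> g \<circ> T"] by (auto simp: fun_eq_iff)
    then show ?thesis unfolding C_def by blast
  qed
  have endo [simp]: "T \<in> endos W" if "C T" for T
    using that by (simp add: C_def)
  have commute: "T (\<rho> g x) = \<rho> g (T x)" if "C T" "g \<in> carrier H" "x \<in> carrier W" for T g x
    using that by (simp add: C_def)
  \<comment> \<open>Unitarity as an adjoint identity: write \<open>y\<close> as
    \<open>\<rho> g (\<rho> (inv g) y)\<close> and cancel \<open>\<rho> g\<close> in both
    arguments.\<close>
  have adj_rho: "cinner W (\<rho> g x) y = cinner W x (\<rho> (inv\<^bsub>H\<^esub> g) y)"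
    if "g \<in> carrier H" "x \<in> carrier W" "y \<in> carrier W" for g x y
  proof -
    have "\<rho> g (\<rho> (inv\<^bsub>H\<^esub> g) y) = (\<rho> (g \<otimes>\<^bsub>H\<^esub> inv\<^bsub>H\<^esub> g)) y"
      using rep that(1) unfolding unitary_rep_def by (metis H.inv_closed comp_apply)
    also have "\<dots> = y"
      using rep that by (simp add: unitary_rep_def)
    finally have "\<rho> g (\<rho> (inv\<^bsub>H\<^esub> g) y) = y" .
    moreover have "cinner W (\<rho> g x) (\<rho> g (\<rho> (inv\<^bsub>H\<^esub> g) y)) = cinner W x (\<rho> (inv\<^bsub>H\<^esub> g) y)"
      using rep that unfolding unitary_rep_def by simp
    ultimately show ?thesis by simp
  qed
  \<comment> \<open>Move \<open>\<rho> g\<close> across the inner product as the operator of the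
    inverse, commute that with \<open>T\<close>, and move it back.\<close>
  have star_C: "C (adj_endo W T)" if T: "C T" for T
  proof -
    have "adj_endo W T (\<rho> g y) = \<rho> g (adj_endo W T y)"
      if g: "g \<in> carrier H" and y: "y \<in> carrier W" for g y
    proof (rule cinner_eqI)
      fix z assume z: "z \<in> carrier W"
      have "cinner W z (adj_endo W T (\<rho> g y)) = cinner W (\<rho> (inv\<^bsub>H\<^esub> g) (T z)) y"
        using T g y z adj_rho[of "inv\<^bsub>H\<^esub> g" "T z" y] by (simp add: cinner_adj_endo)
      also have "\<dots> = cinner W (T (\<rho> (inv\<^bsub>H\<^esub> g) z)) y"
        using commute[OF T] g z by simp
      also have "\<dots> = cinner W z (\<rho> g (adj_endo W T y))"
        using T g y z adj_rho[of "inv\<^bsub>H\<^esub> g" z "adj_endo W T y"] by (simp add: cinner_adj_endo[symmetric])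
      finally show "cinner W z (adj_endo W T (\<rho> g y)) = cinner W z (\<rho> g (adj_endo W T y))" .
    qed (use T g y in simp_all)
    then show ?thesis using T by (simp add: C_def)
  qed
  have scale_C: "C (scale_endo W c T)" if "C T" for c T
    using that by (simp add: C_def endos_scale)
  have add_C: "C (S + T)" if "C S" "C T" for S T
    using that by (simp add: C_def endos_add)
  have comp_C: "C (S \<circ> T)" if "C S" "C T" for S T
    using that by (simp add: C_def)
  have zero_C: "C 0" and id_C: "C (id_endo W)"
    by (simp_all add: C_def)
  have id_comp: "id_endo W \<circ> T = T" "T \<circ> id_endo W = T" if "C T" for T
    using that by (auto intro!: endos_eqI)
  let ?A = "\<lparr>carrier = {T. C T}, monoid.mult = (\<circ>), one = id_endo W, zero = 0, add = (+),
    smult = scale_endo W, star = adj_endo W\<rparr>"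
  have "abelian_group ?A"
  proof (rule abelian_groupI)
    fix T assume "T \<in> carrier ?A"
    then have "scale_endo W (- 1) T \<in> carrier ?A" "scale_endo W (- 1) T \<oplus>\<^bsub>?A\<^esub> T = \<zero>\<^bsub>?A\<^esub>"
      by (auto simp: scale_C fun_eq_iff)
    then show "\<exists>S\<in>carrier ?A. S \<oplus>\<^bsub>?A\<^esub> T = \<zero>\<^bsub>?A\<^esub>" by blast
  qed (simp_all add: add_C zero_C ac_simps)
  moreover have "Group.monoid ?A"
    by (rule monoidI) (simp_all add: comp_C id_C id_comp comp_assoc)
  ultimately have "star_algebra ?A"
    by (rule star_algebraI)
      (simp_all add: star_C scale_C adj_endo_adj_endo adj_endo_add adj_endo_scale adj_endo_comp,
       simp_all add: fun_eq_iff endos_add endos_scale scale_left_distrib scale_right_distrib)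
  then show ?thesis
    by (simp only: commutant_algebra_def carrier_C)
qed

section \<open>The induced representation\<close>

locale induced_representation = G: group G + V: fin_dim_cinner_space V
  for G :: "'g monoid" (structure) and V :: "('v::ab_group_add) cinner_space" +
  fixes K :: "'g set" and \<theta> :: "'g \<Rightarrow> 'v \<Rightarrow> 'v"
  assumes finite_G: "finite (carrier G)" and subgroup_K: "subgroup K G"
    and unitary_\<theta>: "unitary_rep (G\<lparr>carrier := K\<rparr>) V \<theta>"
begin

abbreviation "Ind \<equiv> Ind_space G K V \<theta>"
abbreviation "translate \<equiv> Ind_rep G K V \<theta>"

section \<open>The subgroup \<open>K\<close> and the action \<open>\<theta>\<close>\<close>

lemma K_closed [simp]: "k \<in> K \<Longrightarrow> k \<in> carrier G"
  using subgroup.mem_carrier[OF subgroup_K] .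

lemma K_mult [simp]: "k \<in> K \<Longrightarrow> l \<in> K \<Longrightarrow> k \<otimes> l \<in> K"
  using subgroup.m_closed[OF subgroup_K] .

lemma K_inv [simp]: "k \<in> K \<Longrightarrow> inv k \<in> K"
  using subgroup.m_inv_closed[OF subgroup_K] .

lemma K_one [simp]: "\<one> \<in> K"
  using subgroup.one_closed[OF subgroup_K] .

lemma K_mult_left_iff: "k \<in> K \<Longrightarrow> g \<in> carrier G \<Longrightarrow> k \<otimes> g \<in> K \<longleftrightarrow> g \<in> K"
  by (metis K_closed K_inv K_mult G.inv_closed G.inv_solve_left G.m_closed)

lemma finite_K: "finite K"
  using finite_G by (rule finite_subset[rotated]) auto

lemma card_K [simp]: "card K \<noteq> 0" "K \<noteq> {}"
  using finite_K K_one by (metis card_0_eq empty_iff)+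

lemma card_G: "card (carrier G) \<noteq> 0"
  using finite_G G.one_closed by (auto simp: card_eq_0_iff)

lemma \<theta>_endo [simp]: "k \<in> K \<Longrightarrow> \<theta> k \<in> endos V"
  using unitary_\<theta> by (simp add: unitary_rep_def)

lemma \<theta>_mult: "k \<in> K \<Longrightarrow> l \<in> K \<Longrightarrow> \<theta> (k \<otimes> l) v = \<theta> k (\<theta> l v)"
  using unitary_\<theta> by (simp add: unitary_rep_def)

lemma \<theta>_one_eq: "\<theta> \<one> = id_endo V"
  using unitary_\<theta> by (simp add: unitary_rep_def)

lemma \<theta>_one [simp]: "v \<in> carrier V \<Longrightarrow> \<theta> \<one> v = v"
  by (simp add: \<theta>_one_eq)

lemma \<theta>_inv_right: "k \<in> K \<Longrightarrow> v \<in> carrier V \<Longrightarrow> \<theta> k (\<theta> (inv k) v) = v"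
  using \<theta>_mult[of k "inv k" v] by simp

lemma cinner_\<theta>:
  "k \<in> K \<Longrightarrow> x \<in> carrier V \<Longrightarrow> y \<in> carrier V \<Longrightarrow> cinner V (\<theta> k x) (\<theta> k y) = cinner V x y"
  using unitary_\<theta> by (simp add: unitary_rep_def)

section \<open>Sums over the group and over cosets\<close>

lemma sum_left_translate:
  assumes "g \<in> carrier G"
  shows "(\<Sum>h\<in>carrier G. f (g \<otimes> h)) = (\<Sum>h\<in>carrier G. f h)"
  by (rule sum.reindex_bij_witness[where i = "\<lambda>h. inv g \<otimes> h" and j = "\<lambda>h. g \<otimes> h"])
    (use assms in \<open>simp_all add: G.m_assoc[symmetric]\<close>)

text \<open>Substituting \<open>g \<otimes> h\<close> for \<open>h\<close> moves the coset of
  \<open>g\<close> to \<open>K\<close>. This applies whenever a translate of a function supported on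
  \<open>K\<close> is summed over the group.\<close>

lemma sum_coset:
  fixes f :: "'g \<Rightarrow> 'b::comm_monoid_add"
  assumes g: "g \<in> carrier G"
  shows "(\<Sum>h\<in>carrier G. if inv g \<otimes> h \<in> K then f h else 0) = (\<Sum>k\<in>K. f (g \<otimes> k))"
proof -
  have "(\<Sum>h\<in>carrier G. if inv g \<otimes> h \<in> K then f h else 0)
      = (\<Sum>h\<in>carrier G. if inv g \<otimes> (g \<otimes> h) \<in> K then f (g \<otimes> h) else 0)"
    using sum_left_translate[OF g, of "\<lambda>h. if inv g \<otimes> h \<in> K then f h else 0"] by simp
  also have "\<dots> = (\<Sum>h\<in>carrier G. if h \<in> K then f (g \<otimes> h) else 0)"
    using g by (intro sum.cong) (simp_all add: G.m_assoc[symmetric])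
  also have "\<dots> = (\<Sum>h\<in>carrier G \<inter> K. f (g \<otimes> h))"
    using finite_G by (simp add: sum.If_cases)
  also have "carrier G \<inter> K = K" by auto
  finally show ?thesis .
qed

section \<open>The induced space and its translations\<close>

lemma Ind_iff:
  "f \<in> carrier Ind \<longleftrightarrow> (\<forall>g. g \<notin> carrier G \<longrightarrow> f g = 0) \<and> (\<forall>g\<in>carrier G. f g \<in> carrier V) \<and>
     (\<forall>g\<in>carrier G. \<forall>k\<in>K. f (g \<otimes> k) = \<theta> (inv k) (f g))"
  by (simp add: Ind_space_def)

lemma cscale_Ind [simp]: "cscale Ind c f g = cscale V c (f g)"
  by (simp add: Ind_space_def)

lemma cinner_Ind: "cinner Ind f1 f2 = 1 / of_nat (card K) * (\<Sum>g\<in>carrier G. cinner V (f1 g) (f2 g))"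
  by (simp add: Ind_space_def)

lemma IndI:
  assumes "\<And>g. g \<notin> carrier G \<Longrightarrow> f g = 0" "\<And>g. g \<in> carrier G \<Longrightarrow> f g \<in> carrier V"
    "\<And>g k. g \<in> carrier G \<Longrightarrow> k \<in> K \<Longrightarrow> f (g \<otimes> k) = \<theta> (inv k) (f g)"
  shows "f \<in> carrier Ind"
  using assms unfolding Ind_iff by blast

lemma Ind_outside: "f \<in> carrier Ind \<Longrightarrow> g \<notin> carrier G \<Longrightarrow> f g = 0"
  unfolding Ind_iff by blast

lemma Ind_closed [simp]: "f \<in> carrier Ind \<Longrightarrow> f g \<in> carrier V"
  unfolding Ind_iff by (metis V.zero_closed)

lemma Ind_coset: "f \<in> carrier Ind \<Longrightarrow> g \<in> carrier G \<Longrightarrow> k \<in> K \<Longrightarrow> f (g \<otimes> k) = \<theta> (inv k) (f g)"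
  unfolding Ind_iff by blast

lemma Ind_eqI:
  assumes "f1 \<in> carrier Ind" "f2 \<in> carrier Ind" "\<And>g. g \<in> carrier G \<Longrightarrow> f1 g = f2 g"
  shows "f1 = f2"
proof
  show "f1 g = f2 g" for g
    using assms by (cases "g \<in> carrier G") (simp_all add: Ind_outside)
qed

lemma translate_apply:
  "f \<in> carrier Ind \<Longrightarrow> x \<in> carrier G \<Longrightarrow> translate g f x = f (inv g \<otimes> x)"
  by (simp add: Ind_rep_def)

lemma translate_closed [simp]:
  assumes "f \<in> carrier Ind" "g \<in> carrier G"
  shows "translate g f \<in> carrier Ind"
proof (rule IndI)
  fix x k assume "x \<in> carrier G" "k \<in> K"
  then show "translate g f (x \<otimes> k) = \<theta> (inv k) (translate g f x)"
    using assms by (simp add: translate_apply G.m_assoc[symmetric] Ind_coset)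
qed (use assms in \<open>simp_all add: Ind_rep_def\<close>)

section \<open>Functions supported on \<open>K\<close>, and expansion in their translates\<close>

definition delta :: "'v \<Rightarrow> 'g \<Rightarrow> 'v" where
  "delta v h = (if h \<in> K then cscale V (1 / of_nat (card K)) (\<theta> (inv h) v) else 0)"

lemma delta_closed [simp]:
  assumes "v \<in> carrier V"
  shows "delta v \<in> carrier Ind"
proof (rule IndI)
  fix g k assume g: "g \<in> carrier G" and k: "k \<in> K"
  have "g \<otimes> k \<in> K \<longleftrightarrow> g \<in> K"
    using g k by (metis K_closed K_inv K_mult G.inv_solve_right G.m_closed)
  then show "delta v (g \<otimes> k) = \<theta> (inv k) (delta v g)"
    using assms g k by (simp add: delta_def G.inv_mult_group \<theta>_mult V.endos_scale)
qed (use assms in \<open>auto simp: delta_def\<close>)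

lemma delta_add: "v \<in> carrier V \<Longrightarrow> w \<in> carrier V \<Longrightarrow> delta (v + w) = delta v + delta w"
  by (simp add: delta_def fun_eq_iff V.endos_add V.scale_right_distrib)

lemma delta_scale: "v \<in> carrier V \<Longrightarrow> delta (cscale V c v) = cscale Ind c (delta v)"
  by (simp add: delta_def fun_eq_iff V.endos_scale mult.commute)

text \<open>Since \<open>inv (inv k \<otimes> x)\<close> equals \<open>inv x \<otimes> k\<close>,
  left translation by \<open>k\<close> becomes the action of \<open>k\<close> on \<open>v\<close>.
  This later gives the covariance of \<open>coeff T\<close> under left multiplication by
  \<open>K\<close>.\<close>

lemma translate_delta:
  assumes k: "k \<in> K" and v: "v \<in> carrier V"
  shows "translate k (delta v) = delta (\<theta> k v)"
proof (rule Ind_eqI)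
  fix x assume x: "x \<in> carrier G"
  then show "translate k (delta v) x = delta (\<theta> k v) x"
    using k v by (simp add: translate_apply delta_def K_mult_left_iff G.inv_mult_group \<theta>_mult)
qed (use k v in simp_all)

text \<open>At \<open>x\<close> only the \<open>g\<close> in the left coset of \<open>x\<close>
  contribute, and covariance of \<open>f\<close> makes their contributions equal. Summing over the
  whole group avoids a choice of coset representatives.\<close>

lemma sum_translate_delta:
  assumes f: "f \<in> carrier Ind"
  shows "(\<Sum>g\<in>carrier G. translate g (delta (f g)) x) = f x"
proof (cases "x \<in> carrier G")
  case x: True
  have "(\<Sum>g\<in>carrier G. translate g (delta (f g)) x)
      = (\<Sum>g\<in>carrier G. if inv x \<otimes> g \<in> K
          then cscale V (1 / of_nat (card K)) (\<theta> (inv x \<otimes> g) (f g)) else 0)"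
  proof (rule sum.cong)
    fix g assume g: "g \<in> carrier G"
    \<comment> \<open>Inversion turns the support condition into membership of \<open>g\<close> in
      the coset of \<open>x\<close>, the form required by \<open>sum_coset\<close>.\<close>
    have "inv (inv g \<otimes> x) = inv x \<otimes> g" using g x by (simp add: G.inv_mult_group)
    moreover from this have "inv g \<otimes> x \<in> K \<longleftrightarrow> inv x \<otimes> g \<in> K"
      using g x by (metis K_inv G.inv_inv G.inv_closed G.m_closed)
    ultimately show "translate g (delta (f g)) x
        = (if inv x \<otimes> g \<in> K then cscale V (1 / of_nat (card K)) (\<theta> (inv x \<otimes> g) (f g)) else 0)"
      using f g x by (simp add: translate_apply delta_def)
  qed simp
  also have "\<dots> = (\<Sum>k\<in>K. cscale V (1 / of_nat (card K)) (\<theta> (inv x \<otimes> (x \<otimes> k)) (f (x \<otimes> k))))"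
    using x by (rule sum_coset)
  also have "\<dots> = (\<Sum>k\<in>K. cscale V (1 / of_nat (card K)) (f x))"
    using f x by (intro sum.cong) (simp_all add: Ind_coset G.m_assoc[symmetric] \<theta>_inv_right)
  also have "\<dots> = cscale V (\<Sum>k\<in>K. 1 / of_nat (card K)) (f x)"
    by (simp only: V.scale_sum_left)
  \<comment> \<open>The factor in \<open>delta\<close> is chosen for this: the \<open>card K\<close>
    equal terms of a coset add up to a single one.\<close>
  also have "(\<Sum>k\<in>K. 1 / of_nat (card K)) = (1 :: complex)"
    using card_K by simp
  finally show ?thesis by simp
next
  case False
  then show ?thesis using f by (simp add: Ind_outside)
qed

lemma delta_sum:
  assumes "\<And>i. i \<in> I \<Longrightarrow> v i \<in> carrier V"
  shows "delta (\<Sum>i\<in>I. v i) = (\<Sum>i\<in>I. delta (v i))"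
proof (rule ext)
  show "delta (\<Sum>i\<in>I. v i) h = (\<Sum>i\<in>I. delta (v i)) h" for h
    using assms by (simp add: delta_def sum_fun_apply V.endos_sum V.scale_sum_right)
qed

text \<open>Splitting each value \<open>f g\<close> along \<open>E\<close> refines the sum of
  translates into a linear combination of finitely many fixed functions. It shows finite dimension
  and is the dual family for the trace.\<close>

lemma Ind_expansion:
  assumes E: "V.orthonormal E" "V.span E = carrier V" and f: "f \<in> carrier Ind"
  shows "f = (\<Sum>(g, e)\<in>carrier G \<times> E. cscale Ind (cinner V (f g) e) (translate g (delta e)))"
proof
  fix x
  have EV: "e \<in> carrier V" if "e \<in> E" for e using E that by (auto simp: V.orthonormal_def)
  have "(\<Sum>(g, e)\<in>carrier G \<times> E. cscale Ind (cinner V (f g) e) (translate g (delta e))) x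
      = (\<Sum>g\<in>carrier G. \<Sum>e\<in>E. cscale V (cinner V (f g) e) (translate g (delta e) x))"
    by (simp add: sum_fun_apply sum.cartesian_product case_prod_unfold)
  also have "\<dots> = (\<Sum>g\<in>carrier G. translate g (delta (f g)) x)"
  proof (rule sum.cong)
    fix g assume g: "g \<in> carrier G"
    have "delta (f g) = delta (\<Sum>e\<in>E. cscale V (cinner V (f g) e) e)"
      by (rule arg_cong[OF V.orthonormal_expansion]) (use E f in simp_all)
    also have "\<dots> = (\<Sum>e\<in>E. cscale Ind (cinner V (f g) e) (delta e))"
      using EV by (simp add: delta_sum delta_scale)
    finally have d: "delta (f g) = (\<Sum>e\<in>E. cscale Ind (cinner V (f g) e) (delta e))" .
    show "(\<Sum>e\<in>E. cscale V (cinner V (f g) e) (translate g (delta e) x)) = translate g (delta (f g)) x"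
    proof (cases "x \<in> carrier G")
      case True
      have "translate g (delta (f g)) x = delta (f g) (inv g \<otimes> x)"
        using f True by (simp add: translate_apply)
      also have "\<dots> = (\<Sum>e\<in>E. cscale V (cinner V (f g) e) (translate g (delta e) x))"
        using EV True unfolding d by (simp add: sum_fun_apply translate_apply)
      finally show ?thesis by simp
    next
      case False
      then show ?thesis using f g EV by (simp add: Ind_outside)
    qed
  qed simp
  also have "\<dots> = f x" by (rule sum_translate_delta[OF f])
  finally show "f x = (\<Sum>(g, e)\<in>carrier G \<times> E. cscale Ind (cinner V (f g) e) (translate g (delta e))) x"
    by simp
qed

section \<open>Inner product and unitarity on the induced space\<close>

lemma fin_dim_Ind: "fin_dim_cinner_space Ind"
proof -
  interpret vector_space "cscale Ind"
    by unfold_locales (simp_all add: fun_eq_iff V.scale_left_distrib V.scale_right_distrib)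
  have sub: "subspace (carrier Ind)"
    by (rule subspaceI; rule IndI)
      (simp_all add: Ind_outside Ind_coset V.endos_add V.endos_scale)
  have gen: "\<exists>B. finite B \<and> span B = carrier Ind"
  proof -
    obtain E where E: "V.orthonormal E" "V.span E = carrier V" by (rule V.orthonormal_basis_exists)
    have finE: "finite E" and EV: "\<And>e. e \<in> E \<Longrightarrow> e \<in> carrier V"
      using E(1) by (auto simp: V.orthonormal_def)
    define B where "B = (\<lambda>(g, e). translate g (delta e)) ` (carrier G \<times> E)"
    have "finite B" using finE finite_G by (simp add: B_def)
    moreover have "span B \<subseteq> carrier Ind"
      using sub EV by (intro span_minimal) (auto simp: B_def)
    moreover have "f \<in> span B" if "f \<in> carrier Ind" for f
    proof (subst Ind_expansion[OF E that], rule span_sum)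
      fix p assume "p \<in> carrier G \<times> E"
      then show "(case p of (g, e) \<Rightarrow> cscale Ind (cinner V (f g) e) (translate g (delta e))) \<in> span B"
        by (force simp: B_def intro: span_scale span_base)
    qed
    ultimately show ?thesis by blast
  qed
  have commute: "cinner Ind y x = cnj (cinner Ind x y)"
    if "x \<in> carrier Ind" "y \<in> carrier Ind" for x y
    unfolding cinner_Ind complex_cnj_mult cnj_sum
    using that by (intro arg_cong2[where f = "(*)"] sum.cong V.cinner_commute) simp_all
  show ?thesis
  \<comment> \<open>The numbered cases are additivity (3), homogeneity (4), positivity (6) and
    definiteness (7) of the inner product.\<close>
  proof (unfold_locales, goal_cases)
    case (3 x y z)
    then show ?case
      by (simp add: cinner_Ind V.cinner_add_left sum.distrib ring_distribs add_divide_distrib)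
  next
    case (4 x y c)
    then show ?case
      by (simp add: cinner_Ind V.cinner_scale_left sum_distrib_left)
  next
    case (6 x)
    then show ?case
      by (auto simp: cinner_Ind intro!: divide_nonneg_nonneg sum_nonneg V.cinner_nonneg)
  next
    case (7 x)
    \<comment> \<open>A vanishing sum of nonnegative real parts has vanishing terms; the imaginary
      parts are zero by conjugate symmetry.\<close>
    have "(\<Sum>g\<in>carrier G. cinner V (x g) (x g)) = 0"
      using 7 by (simp add: cinner_Ind)
    then have "(\<Sum>g\<in>carrier G. Re (cinner V (x g) (x g))) = 0"
      by (metis Re_sum zero_complex.simps(1))
    then have Re0: "Re (cinner V (x g) (x g)) = 0" if "g \<in> carrier G" for g
      using that finite_G 7 V.cinner_nonneg by (subst (asm) sum_nonneg_eq_0_iff) auto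
    show ?case
    proof
      fix g
      show "x g = 0 g"
      proof (cases "g \<in> carrier G")
        case True
        have "Im (cinner V (x g) (x g)) = 0"
          using arg_cong[OF V.cinner_commute[of "x g" "x g"], of Im] 7 by simp
        then have "cinner V (x g) (x g) = 0"
          using Re0[OF True] by (simp add: complex_eq_iff)
        then show ?thesis using 7 by (simp add: V.cinner_definite)
      qed (use 7 in \<open>simp add: Ind_outside\<close>)
    qed
  qed (fact sub gen commute)+
qed

sublocale I: fin_dim_cinner_space Ind
  by (rule fin_dim_Ind)

lemma translate_endo [simp]:
  assumes g: "g \<in> carrier G"
  shows "translate g \<in> endos Ind"
proof (rule I.endosI)
  show "translate g f = 0" if "f \<notin> carrier Ind" for f
    using that by (simp add: Ind_rep_def)
  show "translate g (f1 + f2) = translate g f1 + translate g f2"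
    if "f1 \<in> carrier Ind" "f2 \<in> carrier Ind" for f1 f2
    using that g by (intro Ind_eqI) (simp_all add: translate_apply)
  show "translate g (cscale Ind c f) = cscale Ind c (translate g f)" if "f \<in> carrier Ind" for c f
    using that g by (intro Ind_eqI) (simp_all add: translate_apply)
qed (use g in simp)

lemma unitary_translate: "unitary_rep G Ind translate"
  unfolding unitary_rep_def
proof (intro conjI ballI)
  show "translate \<one> = id_endo Ind"
    by (rule I.endos_eqI, simp_all, rule Ind_eqI) (simp_all add: translate_apply)
  show "translate (g \<otimes> h) = translate g \<circ> translate h" if "g \<in> carrier G" "h \<in> carrier G" for g h
    by (rule I.endos_eqI, use that in simp_all, rule Ind_eqI)
      (use that in \<open>simp_all add: translate_apply G.inv_mult_group G.m_assoc\<close>)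
  show "cinner Ind (translate g x) (translate g y) = cinner Ind x y"
    if "g \<in> carrier G" "x \<in> carrier Ind" "y \<in> carrier Ind" for g x y
    using that sum_left_translate[of "inv g" "\<lambda>h. cinner V (x h) (y h)"]
    by (simp add: cinner_Ind translate_apply)
qed simp

text \<open>Translates of \<open>delta v\<close> represent evaluation: the sum collapses to the
  coset of \<open>g\<close>, where unitarity of \<open>\<theta>\<close> makes all terms equal. The
  factor in \<open>delta\<close> cancels their number; the one in the inner product
  survives.\<close>

lemma cinner_translate_delta:
  assumes f: "f \<in> carrier Ind" and g: "g \<in> carrier G" and v: "v \<in> carrier V"
  shows "cinner Ind f (translate g (delta v)) = 1 / of_nat (card K) * cinner V (f g) v"
proof -
  have "(\<Sum>h\<in>carrier G. cinner V (f h) (translate g (delta v) h))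
      = (\<Sum>h\<in>carrier G. if inv g \<otimes> h \<in> K
          then 1 / of_nat (card K) * cinner V (f h) (\<theta> (inv (inv g \<otimes> h)) v) else 0)"
    using f g v by (intro sum.cong) (simp_all add: translate_apply delta_def V.cinner_scale_right)
  also have "\<dots> = (\<Sum>k\<in>K. 1 / of_nat (card K) * cinner V (f (g \<otimes> k)) (\<theta> (inv (inv g \<otimes> (g \<otimes> k))) v))"
    using g by (rule sum_coset)
  also have "\<dots> = (\<Sum>k\<in>K. 1 / of_nat (card K) * cinner V (f g) v)"
    using f g v by (intro sum.cong) (simp_all add: Ind_coset G.m_assoc[symmetric] cinner_\<theta>)
  also have "\<dots> = cinner V (f g) v"
    using card_K by simp
  finally show ?thesis by (simp add: cinner_Ind)
qed

section \<open>The Hecke algebra\<close>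

abbreviation "Hecke \<equiv> Hecke_algebra G K V \<theta>"
abbreviation "xi \<equiv> Hecke_xi G K V \<theta>"
abbreviation "End_Ind \<equiv> End_G_Ind G K V \<theta>"

section \<open>Elements of the Hecke algebra\<close>

lemma Hecke_iff:
  "F \<in> carrier Hecke \<longleftrightarrow> (\<forall>g. g \<notin> carrier G \<longrightarrow> F g = 0) \<and> (\<forall>g\<in>carrier G. F g \<in> endos V) \<and>
     (\<forall>g\<in>carrier G. \<forall>k\<in>K. \<forall>l\<in>K. F (k \<otimes> g \<otimes> l) = \<theta> (inv l) \<circ> F g \<circ> \<theta> (inv k))"
  by (simp add: Hecke_algebra_def)

lemma Hecke_outside: "F \<in> carrier Hecke \<Longrightarrow> g \<notin> carrier G \<Longrightarrow> F g = 0"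
  unfolding Hecke_iff by blast

lemma Hecke_endo [simp]: "F \<in> carrier Hecke \<Longrightarrow> F g \<in> endos V"
  unfolding Hecke_iff by (metis V.zero_endo)

lemma Hecke_bicoset:
  assumes "F \<in> carrier Hecke" "g \<in> carrier G" "k \<in> K" "l \<in> K"
  shows "F (k \<otimes> g \<otimes> l) v = \<theta> (inv l) (F g (\<theta> (inv k) v))"
  using assms unfolding Hecke_iff by simp

lemma Hecke_right:
  assumes "F \<in> carrier Hecke" "g \<in> carrier G" "k \<in> K" "v \<in> carrier V"
  shows "F (g \<otimes> k) v = \<theta> (inv k) (F g v)"
  using Hecke_bicoset[of F g \<one> k v] assms by simp

lemma Hecke_left:
  assumes "F \<in> carrier Hecke" "g \<in> carrier G" "k \<in> K" "v \<in> carrier V"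
  shows "F (k \<otimes> g) v = F g (\<theta> (inv k) v)"
  using Hecke_bicoset[of F g k \<one> v] assms by simp

lemma HeckeI:
  assumes "\<And>g. g \<notin> carrier G \<Longrightarrow> F g = 0" "\<And>g. g \<in> carrier G \<Longrightarrow> F g \<in> endos V"
    "\<And>g k l v. g \<in> carrier G \<Longrightarrow> k \<in> K \<Longrightarrow> l \<in> K \<Longrightarrow> v \<in> carrier V \<Longrightarrow>
       F (k \<otimes> g \<otimes> l) v = \<theta> (inv l) (F g (\<theta> (inv k) v))"
  shows "F \<in> carrier Hecke"
proof -
  have "F (k \<otimes> g \<otimes> l) = \<theta> (inv l) \<circ> F g \<circ> \<theta> (inv k)" if "g \<in> carrier G" "k \<in> K" "l \<in> K" for g k l
    using assms that by (intro V.endos_eqI) simp_all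
  then show ?thesis using assms unfolding Hecke_iff by blast
qed

lemma Hecke_eqI:
  assumes "F1 \<in> carrier Hecke" "F2 \<in> carrier Hecke"
    "\<And>g v. g \<in> carrier G \<Longrightarrow> v \<in> carrier V \<Longrightarrow> F1 g v = F2 g v"
  shows "F1 = F2"
proof
  show "F1 g = F2 g" for g
    using assms by (cases "g \<in> carrier G") (auto simp: Hecke_outside intro: V.endos_eqI)
qed

section \<open>The operators \<open>xi F\<close>\<close>

lemma xi_apply:
  "f \<in> carrier Ind \<Longrightarrow> x \<in> carrier G \<Longrightarrow> xi F f x = (\<Sum>h\<in>carrier G. F (inv h \<otimes> x) (f h))"
  by (simp add: Hecke_xi_def)

text \<open>Right covariance of \<open>F\<close> passes to the sum. Left covariance enters in
  \<open>xi_delta\<close>.\<close>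

lemma xi_closed:
  assumes F: "F \<in> carrier Hecke" and f: "f \<in> carrier Ind"
  shows "xi F f \<in> carrier Ind"
proof (rule IndI)
  fix g k assume "g \<in> carrier G" "k \<in> K"
  then show "xi F f (g \<otimes> k) = \<theta> (inv k) (xi F f g)"
    using F f by (simp add: xi_apply G.m_assoc[symmetric] Hecke_right V.endos_sum)
qed (use F f in \<open>simp_all add: xi_apply V.sum_closed, simp add: Hecke_xi_def\<close>)

lemma xi_endo [simp]:
  assumes F: "F \<in> carrier Hecke"
  shows "xi F \<in> endos Ind"
proof (rule I.endosI)
  show "xi F f = 0" if "f \<notin> carrier Ind" for f
    using that by (simp add: Hecke_xi_def)
  show "xi F (f1 + f2) = xi F f1 + xi F f2" if "f1 \<in> carrier Ind" "f2 \<in> carrier Ind" for f1 f2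
    using that F by (intro Ind_eqI) (simp_all add: xi_closed xi_apply V.endos_add sum.distrib)
  show "xi F (cscale Ind c f) = cscale Ind c (xi F f)" if "f \<in> carrier Ind" for c f
    using that F
    by (intro Ind_eqI) (simp_all add: xi_closed xi_apply V.endos_scale V.scale_sum_right)
qed (use F in \<open>simp add: xi_closed\<close>)

text \<open>The kernel depends only on \<open>inv h \<otimes> x\<close>, which does not change when
  \<open>h\<close> and \<open>x\<close> are both multiplied by \<open>g\<close> from the
  left.\<close>

lemma xi_translate:
  assumes F: "F \<in> carrier Hecke" and f: "f \<in> carrier Ind" and g: "g \<in> carrier G"
  shows "xi F (translate g f) = translate g (xi F f)"
proof (rule Ind_eqI)
  fix x assume x: "x \<in> carrier G"
  have "xi F (translate g f) x = (\<Sum>h\<in>carrier G. F (inv h \<otimes> x) (f (inv g \<otimes> h)))"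
    using f g x by (simp add: xi_apply translate_apply)
  also have "\<dots> = (\<Sum>h\<in>carrier G. F (inv (g \<otimes> h) \<otimes> x) (f (inv g \<otimes> (g \<otimes> h))))"
    using sum_left_translate[OF g, of "\<lambda>h. F (inv h \<otimes> x) (f (inv g \<otimes> h))"] by simp
  also have "\<dots> = (\<Sum>h\<in>carrier G. F (inv h \<otimes> (inv g \<otimes> x)) (f h))"
    using g x by (intro sum.cong) (simp_all add: G.inv_mult_group G.m_assoc G.m_assoc[symmetric, of "inv g" g])
  also have "\<dots> = translate g (xi F f) x"
    using F f g x by (simp add: translate_apply xi_closed xi_apply)
  finally show "xi F (translate g f) x = translate g (xi F f) x" .
qed (use F f g in \<open>simp_all add: xi_closed\<close>)

lemma End_Ind_iff:
  "T \<in> carrier End_Ind \<longleftrightarrow> T \<in> endos Ind \<and>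
     (\<forall>g\<in>carrier G. \<forall>f\<in>carrier Ind. T (translate g f) = translate g (T f))"
proof -
  have "T \<circ> translate g = translate g \<circ> T \<longleftrightarrow> (\<forall>f\<in>carrier Ind. T (translate g f) = translate g (T f))"
    if "T \<in> endos Ind" "g \<in> carrier G" for g
    using that I.endos_eqI[of "T \<circ> translate g" "translate g \<circ> T"] by (auto simp: fun_eq_iff)
  then show ?thesis unfolding commutant_algebra_def by auto
qed

lemma xi_in_End_Ind: "F \<in> carrier Hecke \<Longrightarrow> xi F \<in> carrier End_Ind"
  by (simp add: End_Ind_iff xi_translate)

text \<open>On the support \<open>K\<close> of \<open>delta v\<close>, left covariance of
  \<open>F\<close> cancels the twist by \<open>\<theta>\<close>, leaving \<open>card K\<close> equal
  terms. So \<open>F\<close> can be read off from \<open>xi F\<close>.\<close>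

lemma xi_delta:
  assumes F: "F \<in> carrier Hecke" and v: "v \<in> carrier V" and x: "x \<in> carrier G"
  shows "xi F (delta v) x = F x v"
proof -
  \<comment> \<open>The condition \<open>h \<in> K\<close> is written with \<open>inv \<one>\<close>
    so that \<open>sum_coset\<close> applies to the coset of \<open>\<one>\<close>.\<close>
  have "xi F (delta v) x = (\<Sum>h\<in>carrier G. if inv \<one> \<otimes> h \<in> K
      then F (inv h \<otimes> x) (cscale V (1 / of_nat (card K)) (\<theta> (inv h) v)) else 0)"
    using F v x by (simp add: xi_apply) (intro sum.cong, auto simp: delta_def)
  also have "\<dots> = (\<Sum>k\<in>K. F (inv (\<one> \<otimes> k) \<otimes> x) (cscale V (1 / of_nat (card K)) (\<theta> (inv (\<one> \<otimes> k)) v)))"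
    by (rule sum_coset) simp
  also have "\<dots> = (\<Sum>k\<in>K. cscale V (1 / of_nat (card K)) (F x v))"
    using F v x by (intro sum.cong) (simp_all add: V.endos_scale Hecke_left \<theta>_inv_right)
  also have "\<dots> = cscale V (\<Sum>k\<in>K. 1 / of_nat (card K)) (F x v)"
    by (simp only: V.scale_sum_left)
  also have "(\<Sum>k\<in>K. 1 / of_nat (card K)) = (1 :: complex)"
    using card_K by simp
  finally show ?thesis by simp
qed

section \<open>The inverse of \<open>xi\<close>\<close>

definition coeff :: "(('g \<Rightarrow> 'v) \<Rightarrow> 'g \<Rightarrow> 'v) \<Rightarrow> 'g \<Rightarrow> 'v \<Rightarrow> 'v" where
  "coeff T g v = (if g \<in> carrier G \<and> v \<in> carrier V then T (delta v) g else 0)"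

text \<open>Right covariance holds because \<open>T (delta v)\<close> lies in the induced space;
  left covariance combines \<open>translate_delta\<close> with the commutation of \<open>T\<close>
  and the translations.\<close>

lemma coeff_closed:
  assumes T: "T \<in> carrier End_Ind"
  shows "coeff T \<in> carrier Hecke"
proof (rule HeckeI)
  have endo: "T \<in> endos Ind" using T by (simp add: End_Ind_iff)
  have commute: "T (translate g f) = translate g (T f)" if "g \<in> carrier G" "f \<in> carrier Ind" for g f
    using T that by (simp add: End_Ind_iff)
  show "coeff T g = 0" if "g \<notin> carrier G" for g
    using that by (simp add: coeff_def fun_eq_iff)
  show "coeff T g \<in> endos V" if "g \<in> carrier G" for g
    using that endo
    by (intro V.endosI) (simp_all add: coeff_def delta_add delta_scale I.endos_add I.endos_scale)
  show "coeff T (k \<otimes> g \<otimes> l) v = \<theta> (inv l) (coeff T g (\<theta> (inv k) v))"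
    if "g \<in> carrier G" "k \<in> K" "l \<in> K" "v \<in> carrier V" for g k l v
  proof -
    have "T (delta v) (k \<otimes> g \<otimes> l) = \<theta> (inv l) (T (delta v) (k \<otimes> g))"
      using that endo by (simp add: Ind_coset)
    also have "T (delta v) (k \<otimes> g) = translate (inv k) (T (delta v)) g"
      using that endo by (simp add: translate_apply)
    also have "\<dots> = T (delta (\<theta> (inv k) v)) g"
      using that by (simp add: translate_delta[symmetric] commute)
    finally show ?thesis using that by (simp add: coeff_def)
  qed
qed

lemma coeff_xi:
  assumes "F \<in> carrier Hecke"
  shows "coeff (xi F) = F"
  using assms by (intro Hecke_eqI) (simp_all add: coeff_closed xi_in_End_Ind, simp add: coeff_def xi_delta)

text \<open>An operator commuting with translations is determined by its values on the functions
  \<open>delta v\<close>, since every \<open>f\<close> is a sum of their translates. The sum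
  defining \<open>xi\<close> is \<open>T\<close> applied termwise to this decomposition.\<close>

lemma xi_coeff:
  assumes T: "T \<in> carrier End_Ind"
  shows "xi (coeff T) = T"
proof (rule I.endos_eqI)
  have endo: "T \<in> endos Ind" using T by (simp add: End_Ind_iff)
  show "T \<in> endos Ind" by (rule endo)
  show "xi (coeff T) \<in> endos Ind" using T by (simp add: coeff_closed)
  show "xi (coeff T) f = T f" if f: "f \<in> carrier Ind" for f
  proof (rule Ind_eqI)
    fix x assume x: "x \<in> carrier G"
    have "xi (coeff T) f x = (\<Sum>h\<in>carrier G. translate h (T (delta (f h))) x)"
      using f x endo by (simp add: xi_apply coeff_def translate_apply)
    also have "\<dots> = (\<Sum>h\<in>carrier G. T (translate h (delta (f h)))) x"
      using f T by (simp add: sum_fun_apply End_Ind_iff)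
    also have "\<dots> = T (\<Sum>h\<in>carrier G. translate h (delta (f h))) x"
      using f endo by (simp add: I.endos_sum)
    also have "(\<Sum>h\<in>carrier G. translate h (delta (f h))) = f"
      using f by (simp add: fun_eq_iff sum_fun_apply sum_translate_delta)
    finally show "xi (coeff T) f x = T f x" .
  qed (use f T endo in \<open>simp_all add: coeff_closed\<close>)
qed

text \<open>Reduces each pullback equation below to a computation on \<open>delta v\<close>; the
  last two premises match the default value \<open>0\<close> in \<open>coeff\<close>.\<close>

lemma eq_coeffI:
  assumes "\<And>g v. g \<in> carrier G \<Longrightarrow> v \<in> carrier V \<Longrightarrow> F g v = T (delta v) g"
    "\<And>g v. g \<notin> carrier G \<Longrightarrow> F g v = 0" "\<And>g v. v \<notin> carrier V \<Longrightarrow> F g v = 0"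
  shows "F = coeff T"
proof (intro ext)
  show "F g v = coeff T g v" for g v
    using assms(1)[of g v] assms(2)[of g v] assms(3)[of v g] by (auto simp: coeff_def)
qed

section \<open>The Hecke operations as pullbacks from the commutant\<close>

lemma
  shows Hecke_mult: "(F1 \<otimes>\<^bsub>Hecke\<^esub> F2) g
      = (if g \<in> carrier G then \<Sum>h\<in>carrier G. F1 (inv h \<otimes> g) \<circ> F2 h else 0)"
    and Hecke_one: "\<one>\<^bsub>Hecke\<^esub> g = (if g \<in> K then scale_endo V (1 / of_nat (card K)) (\<theta> (inv g)) else 0)"
    and Hecke_zero: "\<zero>\<^bsub>Hecke\<^esub> = 0"
    and Hecke_add: "F1 \<oplus>\<^bsub>Hecke\<^esub> F2 = F1 + F2"
    and Hecke_smult: "(c \<odot>\<^bsub>Hecke\<^esub> F) g = scale_endo V c (F g)"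
    and Hecke_star: "star Hecke F g = (if g \<in> carrier G then adj_endo V (F (inv g)) else 0)"
  unfolding Hecke_algebra_def
  by (simp_all only: partial_object.simps monoid.simps ring.simps module.simps star_alg.simps)

text \<open>On the group, \<open>xi F2 (delta v)\<close> is the function sending \<open>h\<close> to
  \<open>F2 h v\<close>; applying \<open>xi F1\<close> to it gives the convolution evaluated on
  \<open>v\<close>.\<close>

lemma Hecke_mult_eq:
  assumes "F1 \<in> carrier Hecke" "F2 \<in> carrier Hecke"
  shows "F1 \<otimes>\<^bsub>Hecke\<^esub> F2 = coeff (xi F1 \<circ> xi F2)"
  using assms
  by (intro eq_coeffI)
    (simp_all add: Hecke_mult sum_fun_apply xi_apply[OF xi_closed] xi_delta V.endos_outside)

text \<open>Applied to \<open>v\<close>, the Hecke unit is literally \<open>delta v\<close>, the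
  value of the identity operator at \<open>delta v\<close>.\<close>

lemma Hecke_one_eq: "\<one>\<^bsub>Hecke\<^esub> = coeff (id_endo Ind)"
proof (rule eq_coeffI)
  show "\<one>\<^bsub>Hecke\<^esub> g v = 0" if "g \<notin> carrier G" for g v
    using that K_closed[of g] by (auto simp: Hecke_one)
qed (simp_all add: Hecke_one delta_def V.endos_outside)

lemma Hecke_zero_eq: "\<zero>\<^bsub>Hecke\<^esub> = coeff 0"
  by (rule eq_coeffI) (simp_all add: Hecke_zero)

lemma Hecke_add_eq:
  assumes "F1 \<in> carrier Hecke" "F2 \<in> carrier Hecke"
  shows "F1 \<oplus>\<^bsub>Hecke\<^esub> F2 = coeff (xi F1 + xi F2)"
  using assms
  by (intro eq_coeffI) (simp_all add: Hecke_add xi_delta V.endos_outside Hecke_outside)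

lemma Hecke_smult_eq:
  assumes "F \<in> carrier Hecke"
  shows "c \<odot>\<^bsub>Hecke\<^esub> F = coeff (scale_endo Ind c (xi F))"
  using assms
  by (intro eq_coeffI) (simp_all add: Hecke_smult xi_delta V.endos_outside Hecke_outside)

text \<open>Testing \<open>adj_endo Ind (xi F) (delta v)\<close> against
  \<open>translate g (delta w)\<close> evaluates it at \<open>g\<close>. Moving \<open>xi F\<close>
  to the other argument leaves \<open>xi F (delta w)\<close> evaluated at \<open>inv g\<close>,
  which is \<open>F (inv g) w\<close>.\<close>

lemma Hecke_star_eq:
  assumes F: "F \<in> carrier Hecke"
  shows "star Hecke F = coeff (adj_endo Ind (xi F))"
proof (rule eq_coeffI)
  have "adj_endo V (F (inv g)) v = adj_endo Ind (xi F) (delta v) g"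
    if g: "g \<in> carrier G" and v: "v \<in> carrier V" for g v
  proof (rule V.cinner_eqI)
    fix w assume w: "w \<in> carrier V"
    let ?f = "adj_endo Ind (xi F) (delta v)"
    have f: "?f \<in> carrier Ind" using F v by simp
    have "cinner Ind (translate g (delta w)) ?f = cinner Ind (translate g (xi F (delta w))) (delta v)"
      using F g v w by (simp add: I.cinner_adj_endo xi_translate)
    \<comment> \<open>The trivial translation brings the second argument into the form of the
      evaluation formula.\<close>
    also have "\<dots> = cinner Ind (translate g (xi F (delta w))) (translate \<one> (delta v))"
      using v translate_delta[of \<one> v] by simp
    also have "\<dots> = 1 / of_nat (card K) * cinner V (F (inv g) w) v"
      using F g v w by (subst cinner_translate_delta) (simp_all add: xi_closed translate_apply xi_delta)
    finally have "cinner Ind (translate g (delta w)) ?f = 1 / of_nat (card K) * cinner V (F (inv g) w) v" .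
    \<comment> \<open>Evaluation needs the translate in the second argument, hence two conjugations;
      the factor is real.\<close>
    moreover have "cinner Ind (translate g (delta w)) ?f = 1 / of_nat (card K) * cinner V w (?f g)"
    proof -
      have "cinner Ind (translate g (delta w)) ?f = cnj (cinner Ind ?f (translate g (delta w)))"
        using f g w by (intro I.cinner_commute) simp_all
      also have "\<dots> = 1 / of_nat (card K) * cnj (cinner V (?f g) w)"
        by (subst cinner_translate_delta[OF f g w]) simp
      also have "cnj (cinner V (?f g) w) = cinner V w (?f g)"
        using f w by (intro V.cinner_commute[symmetric]) simp_all
      finally show ?thesis .
    qed
    ultimately have "cinner V (F (inv g) w) v = cinner V w (?f g)"
      using card_K by simp
    then show "cinner V w (adj_endo V (F (inv g)) v) = cinner V w (?f g)"
      using F v w by (simp add: V.cinner_adj_endo)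
  qed (use F v in simp_all)
  then show "star Hecke F g v = adj_endo Ind (xi F) (delta v) g"
    if "g \<in> carrier G" "v \<in> carrier V" for g v
    using that by (simp add: Hecke_star)
qed (use F in \<open>simp_all add: Hecke_star V.endos_outside\<close>)

text \<open>The pullback equations are the premises of the transport lemma once the operations of
  the commutant are unfolded.\<close>

lemma star_isomorphism_xi: "star_isomorphism Hecke End_Ind xi"
proof (rule star_isomorphism_transport[where c = coeff])
  show "star_algebra End_Ind"
    using I.star_algebra_commutant[OF G.group_axioms unitary_translate] .
qed (simp_all only: xi_in_End_Ind coeff_closed coeff_xi xi_coeff Hecke_mult_eq Hecke_one_eq
  Hecke_zero_eq Hecke_add_eq Hecke_smult_eq Hecke_star_eq, simp_all add: commutant_algebra_def)

section \<open>Traces, dimension and scalar products\<close>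

lemma trace_xi:
  assumes F: "F \<in> carrier Hecke"
  shows "trace_endo Ind (xi F) = of_nat (card (carrier G)) * trace_endo V (F \<one>)"
proof -
  obtain E where E: "V.orthonormal E" "V.span E = carrier V" by (rule V.orthonormal_basis_exists)
  have EV: "e \<in> carrier V" if "e \<in> E" for e using E that by (auto simp: V.orthonormal_def)
  have "trace_endo Ind (xi F) = (\<Sum>p\<in>carrier G \<times> E.
      cinner V (xi F (translate (fst p) (delta (snd p))) (fst p)) (snd p))"
  proof (rule I.trace_endo_dual_family)
    show "f = (\<Sum>p\<in>carrier G \<times> E.
        cscale Ind (cinner V (f (fst p)) (snd p)) (translate (fst p) (delta (snd p))))"
      if "f \<in> carrier Ind" for f
      using Ind_expansion[OF E that] by (simp only: case_prod_unfold)
  qed (use F EV in \<open>auto simp: V.cinner_add_left V.cinner_scale_left\<close>)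
  \<comment> \<open>Commuting \<open>xi F\<close> with the translation by \<open>g\<close> and
    evaluating at \<open>g\<close> gives the value at \<open>\<one>\<close>, whatever
    \<open>g\<close> is.\<close>
  also have "\<dots> = (\<Sum>p\<in>carrier G \<times> E. cinner V (F \<one> (snd p)) (snd p))"
    using F EV by (intro sum.cong) (auto simp: xi_translate translate_apply xi_closed xi_delta)
  also have "\<dots> = (\<Sum>g\<in>carrier G. \<Sum>e\<in>E. cinner V (F \<one> e) e)"
    by (simp only: sum.cartesian_product case_prod_unfold)
  also have "\<dots> = of_nat (card (carrier G)) * trace_endo V (F \<one>)"
    using F by (simp add: V.trace_endo_orthonormal[OF _ E])
  finally show ?thesis .
qed

text \<open>The identity operator corresponds to the Hecke unit, whose value at
  \<open>\<one>\<close> is the identity divided by \<open>card K\<close>.\<close>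

lemma dim_Ind:
  "of_nat (I.dim (carrier Ind))
     = (of_nat (card (carrier G)) / of_nat (card K) * of_nat (V.dim (carrier V)) :: complex)"
proof -
  have id: "id_endo Ind \<in> carrier End_Ind"
    by (simp add: End_Ind_iff)
  have "of_nat (I.dim (carrier Ind)) = trace_endo Ind (xi (\<one>\<^bsub>Hecke\<^esub>))"
    using id by (simp add: Hecke_one_eq xi_coeff I.trace_id_endo)
  also have "\<dots> = of_nat (card (carrier G)) * trace_endo V (\<one>\<^bsub>Hecke\<^esub> \<one>)"
    using id by (intro trace_xi) (simp add: Hecke_one_eq coeff_closed)
  also have "\<one>\<^bsub>Hecke\<^esub> \<one> = scale_endo V (1 / of_nat (card K)) (id_endo V)"
    by (simp add: Hecke_one \<theta>_one_eq)
  also have "of_nat (card (carrier G)) * trace_endo V (scale_endo V (1 / of_nat (card K)) (id_endo V))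
      = (of_nat (card (carrier G)) / of_nat (card K) * of_nat (V.dim (carrier V)) :: complex)"
    by (subst V.trace_endo_scale[OF V.id_endo_closed], subst V.trace_id_endo) simp
  finally show ?thesis .
qed

text \<open>The operator under the trace is \<open>xi\<close> of the convolution of
  \<open>star Hecke F2\<close> with \<open>F1\<close>, whose value at \<open>\<one>\<close> is the
  sum of the \<open>adj_endo V (F2 h) \<circ> F1 h\<close>. Dividing by the dimension cancels the
  order of the group and leaves \<open>card K\<close>.\<close>

lemma endo_inner_xi:
  assumes F1: "F1 \<in> carrier Hecke" and F2: "F2 \<in> carrier Hecke"
  shows "endo_inner Ind (xi F1) (xi F2) = of_nat (card K) * Hecke_inner G V F1 F2"
proof -
  have alg: "star_algebra Hecke"
    using star_isomorphism_xi by (simp add: star_isomorphism_def)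
  let ?F = "star Hecke F2 \<otimes>\<^bsub>Hecke\<^esub> F1"
  have star: "star Hecke F2 \<in> carrier Hecke" using star_algebra.star_closed[OF alg F2] .
  have xi_star: "xi (star Hecke F2) = adj_endo Ind (xi F2)"
    using star_isomorphism_xi F2 by (simp add: star_isomorphism_def commutant_algebra_def)
  have hom: "xi \<in> ring_hom Hecke End_Ind"
    using star_isomorphism_xi by (simp add: star_isomorphism_def ring_iso_def)
  have "?F \<in> carrier Hecke"
    using ring.ring_simprules(5)[OF star_algebra.axioms(1)[OF alg] star F1] .
  moreover have "xi ?F = adj_endo Ind (xi F2) \<circ> xi F1"
    unfolding ring_hom_mult[OF hom star F1] xi_star by (simp add: commutant_algebra_def)
  ultimately have "trace_endo Ind (adj_endo Ind (xi F2) \<circ> xi F1)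
      = of_nat (card (carrier G)) * trace_endo V (?F \<one>)"
    using trace_xi[of ?F] by simp
  also have "?F \<one> = (\<Sum>h\<in>carrier G. adj_endo V (F2 h) \<circ> F1 h)"
    by (simp add: Hecke_mult Hecke_star)
  also have "trace_endo V \<dots> = (\<Sum>h\<in>carrier G. trace_endo V (adj_endo V (F2 h) \<circ> F1 h))"
    using F1 F2 by (intro V.trace_endo_sum) simp
  finally have tr: "trace_endo Ind (adj_endo Ind (xi F2) \<circ> xi F1)
      = of_nat (card (carrier G)) * (\<Sum>h\<in>carrier G. trace_endo V (adj_endo V (F2 h) \<circ> F1 h))" .
  have "Hecke_inner G V F1 F2 = 1 / of_nat (V.dim (carrier V))
      * (\<Sum>h\<in>carrier G. trace_endo V (adj_endo V (F2 h) \<circ> F1 h))"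
    by (simp only: Hecke_inner_def endo_inner_def sum_distrib_left)
  \<comment> \<open>This includes \<open>V\<close> of dimension zero: both normalising factors are
    then \<open>0\<close>, as division by zero yields \<open>0\<close>.\<close>
  then show ?thesis
    using card_G card_K(1) unfolding endo_inner_def dim_Ind tr by simp
qed

end

theorem theorem3p5:
  fixes G :: "'g monoid" and K :: "'g set"
    and V :: "('v::ab_group_add) cinner_space" and \<theta> :: "'g \<Rightarrow> 'v \<Rightarrow> 'v"
  assumes "group G" and "finite (carrier G)" and "subgroup K G"
    and "fin_dim_cinner_space V"
    and "unitary_rep (G\<lparr>carrier := K\<rparr>) V \<theta>"
  shows "(\<forall>F\<in>carrier (Hecke_algebra G K V \<theta>).
           Hecke_xi G K V \<theta> F \<in> carrier (End_G_Ind G K V \<theta>)) \<and>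
         (star_isomorphism (Hecke_algebra G K V \<theta>) (End_G_Ind G K V \<theta>) (Hecke_xi G K V \<theta>)) \<and>
         (\<forall>F\<^sub>1\<in>carrier (Hecke_algebra G K V \<theta>). \<forall>F\<^sub>2\<in>carrier (Hecke_algebra G K V \<theta>).
           endo_inner (Ind_space G K V \<theta>) (Hecke_xi G K V \<theta> F\<^sub>1) (Hecke_xi G K V \<theta> F\<^sub>2)
             = of_nat (card K) * Hecke_inner G V F\<^sub>1 F\<^sub>2) \<and>
         (\<forall>F\<^sub>1\<in>carrier (Hecke_algebra G K V \<theta>). \<forall>F\<^sub>2\<in>carrier (Hecke_algebra G K V \<theta>).
           endo_inner (Ind_space G K V \<theta>)
               (scale_endo (Ind_space G K V \<theta>) (1 / of_real (sqrt (real (card K))))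
                  (Hecke_xi G K V \<theta> F\<^sub>1))
               (scale_endo (Ind_space G K V \<theta>) (1 / of_real (sqrt (real (card K))))
                  (Hecke_xi G K V \<theta> F\<^sub>2))
             = Hecke_inner G V F\<^sub>1 F\<^sub>2)"
proof -
  interpret induced_representation G V K \<theta>
    using assms by (intro induced_representation.intro induced_representation_axioms.intro)
  have "complex_of_real (sqrt (real (card K))) * complex_of_real (sqrt (real (card K))) = of_nat (card K)"
    by (metis of_real_mult of_real_of_nat_eq of_nat_0_le_iff real_sqrt_mult_self abs_of_nonneg)
  \<comment> \<open>The normalising factor is its own conjugate, so sesquilinearity contributes its
    square.\<close>
  then have "1 / complex_of_real (sqrt (real (card K))) * cnj (1 / complex_of_real (sqrt (real (card K))))
      * of_nat (card K) = 1"
    using card_K by simp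
  then have "endo_inner Ind (scale_endo Ind (1 / of_real (sqrt (real (card K)))) (xi F1))
        (scale_endo Ind (1 / of_real (sqrt (real (card K)))) (xi F2)) = Hecke_inner G V F1 F2"
    if "F1 \<in> carrier Hecke" "F2 \<in> carrier Hecke" for F1 F2
    using that by (simp only: I.endo_inner_scale xi_endo endo_inner_xi mult.assoc[symmetric] mult_1_left)
  then show ?thesis
    using xi_in_End_Ind star_isomorphism_xi endo_inner_xi by blast
qed

end
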